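(* Let $\alpha,\beta,\gamma\in\mathbb{C}$ and put $$P_1=\frac{\alpha}{v_1}+\frac{\beta}{v_1-1}+\frac{\gamma}{v_1-v_2},\quad P_2=\frac{\alpha}{v_2}+\frac{\beta}{v_2-1}+\frac{\gamma}{v_2-v_1},$$ $$F_1=\frac{-\gamma v_2(v_2-1)}{v_1(v_1-1)(v_1-v_2)},\quad F_2=\frac{-\gamma v_1(v_1-1)}{v_2(v_2-1)(v_2-v_1)}.$$ Consider the system of linear partial differential equations for $z=z(v_1,v_2)$: $$\frac{\partial^2 z}{\partial v_1^2}+\frac13 P_1\frac{\partial z}{\partial v_1}-F_1\frac{\partial z}{\partial v_2}+\Big(\frac{\partial F_1}{\partial v_2}-\frac13\frac{\partial P_1}{\partial v_1}-\frac29P_1^2-\frac23F_1P_2\Big)z=0,$$ $$\frac{\partial^2 z}{\partial v_1\partial v_2}-\frac13 P_2\frac{\partial z}{\partial v_1}-\frac13 P_1\frac{\partial z}{\partial v_2}+\Big(\frac13\frac{\partial P_2}{\partial v_1}+\frac13\frac{\partial P_1}{\partial v_2}+\frac19P_1P_2-F_1F_2\Big)z=0,$$ $$\frac{\partial^2 z}{\partial v_2^2}+\frac13 P_2\frac{\partial z}{\partial v_2}-F_2\frac{\partial z}{\partial v_1}+\Big(\frac{\partial F_2}{\partial v_1}-\frac13\frac{\partial P_2}{\partial v_2}-\frac29P_2^2-\frac23F_2P_1\Big)z=0.$$ For a solution $z$, set $w=v_1^{-\alpha/3}v_2^{-\alpha/3}(v_1-1)^{-\beta/3}(v_2-1)^{-\beta/3}(v_1-v_2)^{2\gamma/3}z$.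 Then $w$ satisfies $$\frac{\partial^2 w}{\partial v_1^2}+\Big(\frac{\alpha}{v_1}+\frac{\beta}{v_1-1}+\frac{-\gamma}{v_1-v_2}\Big)\frac{\partial w}{\partial v_1}+\frac{\gamma v_2(v_2-1)}{v_1(v_1-1)(v_1-v_2)}\frac{\partial w}{\partial v_2}+\frac{(1-\alpha-\beta)\gamma}{v_1(v_1-1)}w=0,$$ $$\frac{\partial^2 w}{\partial v_2^2}+\Big(\frac{\alpha}{v_2}+\frac{\beta}{v_2-1}+\frac{-\gamma}{v_2-v_1}\Big)\frac{\partial w}{\partial v_2}+\frac{\gamma v_1(v_1-1)}{v_2(v_2-1)(v_2-v_1)}\frac{\partial w}{\partial v_1}+\frac{(1-\alpha-\beta)\gamma}{v_2(v_2-1)}w=0,$$ $$\frac{\partial^2 w}{\partial v_1\partial v_2}=\frac{-\gamma}{v_1-v_2}\frac{\partial w}{\partial v_1}+\frac{\gamma}{v_1-v_2}\frac{\partial w}{\partial v_2}.$$ A solution of this last system is given by $w=C_1F_1(\alpha+\beta-1;-\gamma,-\gamma;\alpha-\gamma;v_1,v_2)+C_2F_1(\alpha+\beta-1;-\gamma,-\gamma;\beta-\gamma;1-v_1,1-v_2)$ for constants $C_1,C_2$; consequently $$z=v_1^{\alpha/3}v_2^{\alpha/3}(v_1-1)^{\beta/3}(v_2-1)^{\beta/3}(v_1-v_2)^{-2\gamma/3}\big[C_1F_1(\alpha+\beta-1;-\gamma,-\gamma;\alpha-\gamma;v_1,v_2)+C_2F_1(\alpha+\beta-1;-\gamma,-\gamma;\beta-\gamma;1-v_1,1-v_2)\big]$$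 is a solution of the first system.
   Context: $F_1(a;b,b';c;x,y)=\sum_{m,n\ge0}\frac{(a)_{m+n}(b)_m(b')_n}{(c)_{m+n}\,m!\,n!}x^my^n$ is the Appell hypergeometric function of two variables, where $(q)_k=q(q+1)\cdots(q+k-1)$ is the Pochhammer symbol. (The symbol $F_1$ with arguments $(\ldots;\ldots;\ldots;\ldots,\ldots)$ denotes this function, while $F_1$ with no arguments denotes the rational function above.) All powers are understood for suitable branches on a simply connected domain. *)

theory Defs
  imports "HOL-Complex_Analysis.Complex_Analysis"
begin

text \<open>Functions of \<open>(v\<^sub>1, v\<^sub>2)\<close> are total functions on \<^typ>\<open>complex \<times> complex\<close>; only their values on
  the open set under consideration matter.\<close>

definition holomorphic2_on :: "(complex \<times> complex \<Rightarrow> complex) \<Rightarrow> (complex \<times> complex) set \<Rightarrow> bool"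
    (infixl \<open>holomorphic2'_on\<close> 50) where
  "f holomorphic2_on D \<longleftrightarrow>
     (\<forall>p\<in>D. \<exists>a b. (f has_derivative (\<lambda>(h, k). a * h + b * k)) (at p within D))"

definition pd1 :: "(complex \<times> complex \<Rightarrow> complex) \<Rightarrow> complex \<times> complex \<Rightarrow> complex" where
  "pd1 f = (\<lambda>(v1, v2). deriv (\<lambda>t. f (t, v2)) v1)"

definition pd2 :: "(complex \<times> complex \<Rightarrow> complex) \<Rightarrow> complex \<times> complex \<Rightarrow> complex" where
  "pd2 f = (\<lambda>(v1, v2). deriv (\<lambda>t. f (v1, t)) v2)"

definition coeff_P1 :: "complex \<Rightarrow> complex \<Rightarrow> complex \<Rightarrow> complex \<times> complex \<Rightarrow> complex" where
  "coeff_P1 \<alpha> \<beta> \<gamma> = (\<lambda>(v1, v2). \<alpha> / v1 + \<beta> / (v1 - 1) + \<gamma> / (v1 - v2))"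

definition coeff_P2 :: "complex \<Rightarrow> complex \<Rightarrow> complex \<Rightarrow> complex \<times> complex \<Rightarrow> complex" where
  "coeff_P2 \<alpha> \<beta> \<gamma> = (\<lambda>(v1, v2). \<alpha> / v2 + \<beta> / (v2 - 1) + \<gamma> / (v2 - v1))"

definition coeff_F1 :: "complex \<Rightarrow> complex \<times> complex \<Rightarrow> complex" where
  "coeff_F1 \<gamma> = (\<lambda>(v1, v2). (- \<gamma> * v2 * (v2 - 1)) / (v1 * (v1 - 1) * (v1 - v2)))"

definition coeff_F2 :: "complex \<Rightarrow> complex \<times> complex \<Rightarrow> complex" where
  "coeff_F2 \<gamma> = (\<lambda>(v1, v2). (- \<gamma> * v1 * (v1 - 1)) / (v2 * (v2 - 1) * (v2 - v1)))"

definition solves_z_system ::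
    "complex \<Rightarrow> complex \<Rightarrow> complex \<Rightarrow> (complex \<times> complex) set \<Rightarrow> (complex \<times> complex \<Rightarrow> complex) \<Rightarrow> bool" where
  "solves_z_system \<alpha> \<beta> \<gamma> D z \<longleftrightarrow> z holomorphic2_on D \<and>
    (let P1 = coeff_P1 \<alpha> \<beta> \<gamma>; P2 = coeff_P2 \<alpha> \<beta> \<gamma>; F1 = coeff_F1 \<gamma>; F2 = coeff_F2 \<gamma> in
     \<forall>v\<in>D.
       pd1 (pd1 z) v + 1/3 * P1 v * pd1 z v - F1 v * pd2 z v
         + (pd2 F1 v - 1/3 * pd1 P1 v - 2/9 * (P1 v)\<^sup>2 - 2/3 * F1 v * P2 v) * z v = 0 \<and>
       pd1 (pd2 z) v - 1/3 * P2 v * pd1 z v - 1/3 * P1 v * pd2 z v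
         + (1/3 * pd1 P2 v + 1/3 * pd2 P1 v + 1/9 * P1 v * P2 v - F1 v * F2 v) * z v = 0 \<and>
       pd2 (pd2 z) v + 1/3 * P2 v * pd2 z v - F2 v * pd1 z v
         + (pd1 F2 v - 1/3 * pd2 P2 v - 2/9 * (P2 v)\<^sup>2 - 2/3 * F2 v * P1 v) * z v = 0)"

definition solves_w_system ::
    "complex \<Rightarrow> complex \<Rightarrow> complex \<Rightarrow> (complex \<times> complex) set \<Rightarrow> (complex \<times> complex \<Rightarrow> complex) \<Rightarrow> bool" where
  "solves_w_system \<alpha> \<beta> \<gamma> D w \<longleftrightarrow> w holomorphic2_on D \<and>
    (\<forall>(v1, v2)\<in>D.
       pd1 (pd1 w) (v1, v2)
         + (\<alpha> / v1 + \<beta> / (v1 - 1) + (- \<gamma>) / (v1 - v2)) * pd1 w (v1, v2)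
         + (\<gamma> * v2 * (v2 - 1)) / (v1 * (v1 - 1) * (v1 - v2)) * pd2 w (v1, v2)
         + ((1 - \<alpha> - \<beta>) * \<gamma>) / (v1 * (v1 - 1)) * w (v1, v2) = 0 \<and>
       pd2 (pd2 w) (v1, v2)
         + (\<alpha> / v2 + \<beta> / (v2 - 1) + (- \<gamma>) / (v2 - v1)) * pd2 w (v1, v2)
         + (\<gamma> * v1 * (v1 - 1)) / (v2 * (v2 - 1) * (v2 - v1)) * pd1 w (v1, v2)
         + ((1 - \<alpha> - \<beta>) * \<gamma>) / (v2 * (v2 - 1)) * w (v1, v2) = 0 \<and>
       pd1 (pd2 w) (v1, v2)
         = (- \<gamma>) / (v1 - v2) * pd1 w (v1, v2) + \<gamma> / (v1 - v2) * pd2 w (v1, v2))"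

text \<open>\<open>p\<close> is a branch of \<open>g\<^sup>s\<close> on \<open>D\<close>, i.e. \<open>exp (s \<cdot> log g)\<close> for a continuous logarithm of \<open>g\<close>.\<close>

definition power_branch ::
    "(complex \<times> complex) set \<Rightarrow> (complex \<times> complex \<Rightarrow> complex) \<Rightarrow> complex
      \<Rightarrow> (complex \<times> complex \<Rightarrow> complex) \<Rightarrow> bool" where
  "power_branch D g s p \<longleftrightarrow>
     (\<exists>L. continuous_on D L \<and> (\<forall>v\<in>D. exp (L v) = g v \<and> p v = exp (s * L v)))"

text \<open>The double series converges absolutely for \<open>\<bar>x\<bar> < 1\<close>, \<open>\<bar>y\<bar> < 1\<close>, provided that \<open>c\<close> is not a
  nonpositive integer.\<close>

definition appell_F1 ::
    "complex \<Rightarrow> complex \<Rightarrow> complex \<Rightarrow> complex \<Rightarrow> complex \<Rightarrow> complex \<Rightarrow> complex" where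
  "appell_F1 a b b' c x y =
     (\<Sum>\<^sub>\<infinity>(m, n)\<in>(UNIV :: (nat \<times> nat) set).
        (pochhammer a (m + n) * pochhammer b m * pochhammer b' n)
          / (pochhammer c (m + n) * fact m * fact n) * x ^ m * y ^ n)"

text \<open>\<open>appell_F1_branch a b b' c D f\<close>: on the domain \<open>D\<close>, \<open>f\<close> is (a branch of) the Appell function,
  namely the series itself inside the bidisc of convergence, and elsewhere an analytic continuation
  of it along a finite chain of domains.\<close>

inductive appell_F1_branch ::
    "complex \<Rightarrow> complex \<Rightarrow> complex \<Rightarrow> complex \<Rightarrow> (complex \<times> complex) set
      \<Rightarrow> (complex \<times> complex \<Rightarrow> complex) \<Rightarrow> bool"
  for a b b' c where
  series: "appell_F1_branch a b b' c D f"
    if "open D" "connected D" "D \<subseteq> ball 0 1 \<times> ball 0 1"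
       "\<And>x y. (x, y) \<in> D \<Longrightarrow> f (x, y) = appell_F1 a b b' c x y"
| continuation: "appell_F1_branch a b b' c D' f'"
    if "appell_F1_branch a b b' c D f"
       "open D'" "connected D'" "f' holomorphic2_on D'"
       "open U" "U \<noteq> {}" "U \<subseteq> D \<inter> D'" "\<And>v. v \<in> U \<Longrightarrow> f' v = f v"

end

theory Submission
  imports Defs
begin

text \<open>If \<open>u\<close> has logarithmic partial derivatives \<open>A = u\<^sub>1 / u\<close> and \<open>B = u\<^sub>2 / u\<close>, then every second order
  partial derivative of \<open>u z\<close> is \<open>u\<close> times a linear expression in the derivatives of \<open>z\<close>. For the given product
  of powers, \<open>A\<close> and \<open>B\<close> are \<open>P\<^sub>1\<close> and \<open>P\<^sub>2\<close> with parameters \<open>-\<alpha>/3, -\<beta>/3, 2\<gamma>/3\<close>, and the equivalence of the two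
  systems reduces to identities between rational functions.

  The Appell series satisfies Appell's differential equations by the recurrences for its coefficients.
  Cleared of denominators, these equations make sense on every domain, singular or not, so by the identity
  theorem in two variables they survive analytic continuation along an arbitrary chain of domains. On the
  nonsingular set they are equivalent to the \<open>w\<close>-system, which the reflection \<open>v \<mapsto> 1 - v\<close> preserves
  with \<open>\<alpha>\<close> and \<open>\<beta>\<close> exchanged.\<close>

section \<open>Holomorphic functions of two variables\<close>

text \<open>\<open>holomorphic2_on\<close> asks only for a complex-linear derivative at each point,
  while both systems are of second order. Holomorphy of the partial derivatives therefore has to be
  proved, from Cauchy's integral formula in one variable and Osgood's lemma.

  The exponents of the power product are forced by the mixed equation. Its first-order coefficients
  for \<open>z\<close> are \<open>-P2/3\<close> and \<open>-P1/3\<close>; to become those of the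
  mixed equation for \<open>w\<close>, the logarithmic partials must be
  \<open>A = \<gamma>/(v1 - v2) - P1/3\<close> and \<open>B = -\<gamma>/(v1 - v2) - P2/3\<close>.
  This yields -\<alpha>/3 and -\<beta>/3, and \<gamma> - \<gamma>/3 = 2\<gamma>/3 for the factor
  \<open>v1 - v2\<close>.

  The mixed equation for \<open>w\<close> is an Euler-Poisson-Darboux equation, which the Appell
  series satisfies besides Appell's two classical equations. It is kept as a third equation
  throughout, because it eliminates the mixed derivative from the other two and so produces the
  \<open>w\<close>-system.\<close>

lemma holomorphic2_has_derivative:
  assumes "f holomorphic2_on D" "open D" "v \<in> D"
  obtains a b where "(f has_derivative (\<lambda>(h, k). a * h + b * k)) (at v)"
  using assms unfolding holomorphic2_on_def by (metis at_within_open)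

lemma has_derivative_imp_partials:
  fixes f :: "complex \<times> complex \<Rightarrow> complex"
  assumes "(f has_derivative (\<lambda>(h, k). a * h + b * k)) (at (x, y))"
  shows "((\<lambda>t. f (t, y)) has_field_derivative a) (at x)"
    and "((\<lambda>t. f (x, t)) has_field_derivative b) (at y)"
proof -
  have 1: "((\<lambda>t::complex. (t, y)) has_derivative (\<lambda>h. (h, 0))) (at x)"
    by (auto intro!: derivative_eq_intros)
  have 2: "((\<lambda>t::complex. (x, t)) has_derivative (\<lambda>h. (0, h))) (at y)"
    by (auto intro!: derivative_eq_intros)
  show "((\<lambda>t. f (t, y)) has_field_derivative a) (at x)"
    using has_derivative_compose[OF 1 assms] by (simp add: has_field_derivative_def)
  show "((\<lambda>t. f (x, t)) has_field_derivative b) (at y)"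
    using has_derivative_compose[OF 2 assms] by (simp add: has_field_derivative_def)
qed

lemma holomorphic2_partials:
  assumes "f holomorphic2_on D" "open D" "(x, y) \<in> D"
  shows "((\<lambda>t. f (t, y)) has_field_derivative pd1 f (x, y)) (at x)"
    and "((\<lambda>t. f (x, t)) has_field_derivative pd2 f (x, y)) (at y)"
proof -
  obtain a b where "(f has_derivative (\<lambda>(h, k). a * h + b * k)) (at (x, y))"
    using holomorphic2_has_derivative[OF assms] .
  note * = has_derivative_imp_partials[OF this]
  from *[THEN DERIV_imp_deriv] show "((\<lambda>t. f (t, y)) has_field_derivative pd1 f (x, y)) (at x)"
    and "((\<lambda>t. f (x, t)) has_field_derivative pd2 f (x, y)) (at y)"
    using * by (simp_all add: pd1_def pd2_def)
qed

lemma holomorphic2_imp_continuous_on: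
  "f holomorphic2_on D \<Longrightarrow> continuous_on D f"
  unfolding holomorphic2_on_def continuous_on_eq_continuous_within
  using has_derivative_continuous by blast

section \<open>Separate holomorphy, Cauchy's formula with parameters, and Osgood's lemma\<close>

definition separately_holomorphic where
  "separately_holomorphic f D \<longleftrightarrow> continuous_on D f \<and>
     (\<forall>x y. (x, y) \<in> D \<longrightarrow> ((\<lambda>t. f (t, y)) has_field_derivative pd1 f (x, y)) (at x) \<and>
        ((\<lambda>t. f (x, t)) has_field_derivative pd2 f (x, y)) (at y))"

lemma separately_holomorphicI:
  assumes "continuous_on D f"
    and "\<And>x y. (x, y) \<in> D \<Longrightarrow> (\<lambda>t. f (t, y)) field_differentiable at x"
    and "\<And>x y. (x, y) \<in> D \<Longrightarrow> (\<lambda>t. f (x, t)) field_differentiable at y"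
  shows "separately_holomorphic f D"
  unfolding separately_holomorphic_def using assms
  by (auto simp: pd1_def pd2_def field_differentiable_derivI)

lemma open_contains_cball_times:
  fixes D :: "('a::metric_space \<times> 'b::metric_space) set"
  assumes "open D" "(x, y) \<in> D"
  obtains r where "r > 0" "cball x r \<times> cball y r \<subseteq> D"
proof -
  obtain A B where AB: "open A" "open B" "x \<in> A" "y \<in> B" "A \<times> B \<subseteq> D"
    using assms by (auto elim!: open_prod_elim)
  obtain r s where "r > 0" "cball x r \<subseteq> A" "s > 0" "cball y s \<subseteq> B"
    using AB open_contains_cball by metis
  then have "min r s > 0" "cball x (min r s) \<times> cball y (min r s) \<subseteq> A \<times> B"
    by auto
  then show ?thesis using that AB(5) by blast
qed

text \<open>Cauchy's formula for the derivative, with the contour integral written out over the unit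
  interval so that the theorems on integrals depending on a parameter apply. The last factor is the
  velocity of the circle. The second variable enters only through the integrand.\<close>

lemma pd1_Cauchy_integral:
  assumes "separately_holomorphic f D" "cball x0 r \<times> cball y0 r \<subseteq> D"
    and "x \<in> ball x0 r" "y \<in> ball y0 r"
  shows "pd1 f (x, y) = 1 / (2 * of_real pi * \<i>) * integral (cbox 0 1)
     (\<lambda>t. f (circlepath x0 r t, y) / (circlepath x0 r t - x)\<^sup>2
        * (2 * pi * \<i> * r * exp (2 * of_real pi * \<i> * t)))"
proof -
  have y: "y \<in> cball y0 r" using assms(4) by simp
  have D: "((\<lambda>t. f (t, y)) has_field_derivative pd1 f (u, y)) (at u)" if "u \<in> cball x0 r" for u
    using assms(1,2) y that unfolding separately_holomorphic_def by blast
  have 1: "continuous_on (cball x0 r) (\<lambda>t. f (t, y))"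
    by (rule DERIV_continuous_on, rule has_field_derivative_at_within, rule D)
  have 2: "(\<lambda>t. f (t, y)) holomorphic_on ball x0 r"
  proof (rule holomorphic_onI)
    fix u assume "u \<in> ball x0 r"
    then have "((\<lambda>t. f (t, y)) has_field_derivative pd1 f (u, y)) (at u)" by (intro D) simp
    then show "(\<lambda>t. f (t, y)) field_differentiable at u within ball x0 r"
      unfolding field_differentiable_def using has_field_derivative_at_within by blast
  qed
  have "((\<lambda>t. f (t, y)) has_field_derivative (1 / (2 * of_real pi * \<i>) *
     contour_integral (circlepath x0 r) (\<lambda>u. f (u, y) / (u - x)^2))) (at x)"
    by (rule Cauchy_derivative_integral_circlepath[OF 1 2 assms(3)])
  then have "pd1 f (x, y) = 1 / (2 * of_real pi * \<i>) *
     contour_integral (circlepath x0 r) (\<lambda>u. f (u, y) / (u - x)^2)"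
    using DERIV_unique D[of x] assms(3) by simp
  then show ?thesis
    by (simp add: contour_integral_integral vector_derivative_circlepath mult_ac)
qed

lemma circlepath_in:
  assumes "r > 0" "x \<in> ball x0 r"
  shows "circlepath x0 r t \<in> cball x0 r" "circlepath x0 r t \<noteq> x"
proof -
  have "dist x0 (circlepath x0 r t) = r"
    using assms by (simp add: circlepath dist_norm norm_mult)
  then show "circlepath x0 r t \<in> cball x0 r" "circlepath x0 r t \<noteq> x"
    using assms by auto
qed

text \<open>The density \<open>g\<close> is kept general because the kernel is needed both with
  \<open>f\<close> and, after differentiation under the integral, with \<open>pd2 f\<close>.\<close>

lemma continuous_on_Cauchy_kernel:
  fixes g :: "complex \<times> complex \<Rightarrow> complex"
  assumes g: "continuous_on D g" and sub: "cball x0 r \<times> cball y0 r \<subseteq> D" and "r > 0"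
  shows "continuous_on ((ball x0 r \<times> ball y0 r) \<times> cbox 0 1) (\<lambda>(v, t).
     g (circlepath x0 r t, snd v) / (circlepath x0 r t - fst v)\<^sup>2
        * (2 * pi * \<i> * r * exp (2 * of_real pi * \<i> * of_real t)))"
proof -
  have c: "continuous_on S (\<lambda>p. circlepath x0 r (snd p))" for S :: "((complex \<times> complex) \<times> real) set"
    by (simp add: circlepath) (intro continuous_intros)
  have "continuous_on ((ball x0 r \<times> ball y0 r) \<times> cbox 0 1)
     (\<lambda>p. (circlepath x0 r (snd p), snd (fst p)))"
    by (intro continuous_on_Pair c continuous_intros)
  moreover have "(\<lambda>p. (circlepath x0 r (snd p), snd (fst p))) ` ((ball x0 r \<times> ball y0 r) \<times> cbox 0 1) \<subseteq> D"
    using sub circlepath_in(1)[of r x0 x0] assms(3) by (force simp del: mem_cball simp: mem_ball_imp_mem_cball)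
  ultimately have "continuous_on ((ball x0 r \<times> ball y0 r) \<times> cbox 0 1)
     (\<lambda>p. g (circlepath x0 r (snd p), snd (fst p)))"
    by (rule continuous_on_compose2[OF g])
  then show ?thesis
    unfolding case_prod_beta
    by (intro continuous_intros c) (use circlepath_in(2)[OF \<open>r > 0\<close>] in auto)
qed

lemma continuous_on_pd1:
  assumes "separately_holomorphic f D" "open D"
  shows "continuous_on D (pd1 f)"
proof (rule continuous_at_imp_continuous_on, clarify)
  fix x0 y0 assume "(x0, y0) \<in> D"
  then obtain r where r: "r > 0" "cball x0 r \<times> cball y0 r \<subseteq> D"
    using open_contains_cball_times assms(2) by blast
  have "continuous_on (ball x0 r \<times> ball y0 r) (\<lambda>v. 1 / (2 * of_real pi * \<i>) * integral (cbox 0 1)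
     (\<lambda>t. f (circlepath x0 r t, snd v) / (circlepath x0 r t - fst v)\<^sup>2
        * (2 * pi * \<i> * r * exp (2 * of_real pi * \<i> * t))))"
    by (intro continuous_on_mult_left integral_continuous_on_param continuous_on_Cauchy_kernel[OF _ r(2,1)])
       (use assms in \<open>simp add: separately_holomorphic_def\<close>)
  then have "continuous_on (ball x0 r \<times> ball y0 r) (pd1 f)"
    by (rule continuous_on_cong[THEN iffD1, rotated -1]) (auto simp: pd1_Cauchy_integral[OF assms(1) r(2)])
  then show "isCont (pd1 f) (x0, y0)"
    using r by (simp add: continuous_on_eq_continuous_at open_Times)
qed

text \<open>Exchanging the variables reduces the continuity and holomorphy of \<open>pd2\<close> to
  the corresponding facts on \<open>pd1\<close>.\<close>

lemma pd_swap: "pd1 (f \<circ> prod.swap) = pd2 f \<circ> prod.swap" "pd2 (f \<circ> prod.swap) = pd1 f \<circ> prod.swap"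
  by (auto simp: pd1_def pd2_def fun_eq_iff)

lemma continuous_on_prod_swap: "continuous_on S prod.swap"
proof -
  have "continuous_on S (\<lambda>p. (snd p, fst p))" by (intro continuous_intros)
  then show ?thesis by (simp add: prod.swap_def)
qed

lemma open_swap:
  fixes D :: "('a::topological_space \<times> 'b::topological_space) set"
  assumes "open D"
  shows "open (prod.swap ` D)"
proof -
  have "prod.swap ` D = prod.swap -` D" by force
  moreover have "open (prod.swap -` D :: ('b \<times> 'a) set)"
    by (rule open_vimage[OF assms continuous_on_prod_swap])
  ultimately show ?thesis by simp
qed

lemma separately_holomorphic_swap:
  assumes "separately_holomorphic f D"
  shows "separately_holomorphic (f \<circ> prod.swap) (prod.swap ` D)"
  unfolding separately_holomorphic_def
proof (intro conjI allI impI)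
  show "continuous_on (prod.swap ` D) (f \<circ> prod.swap)"
    using assms unfolding separately_holomorphic_def
    by (intro continuous_on_compose continuous_on_prod_swap) (simp add: image_image)
qed (use assms in \<open>auto simp: separately_holomorphic_def pd_swap\<close>)

lemma continuous_on_pd2:
  assumes "separately_holomorphic f D" "open D"
  shows "continuous_on D (pd2 f)"
proof -
  have "continuous_on (prod.swap ` D) (pd2 f \<circ> prod.swap)"
    using continuous_on_pd1[OF separately_holomorphic_swap open_swap] assms by (simp add: pd_swap)
  then have "continuous_on (prod.swap ` D) (\<lambda>v. pd2 f (prod.swap v))" by (simp add: o_def)
  from continuous_on_compose2[OF this continuous_on_prod_swap[of D]] show ?thesis by simp
qed

text \<open>In the first variable \<open>pd1 f\<close> is the derivative of a holomorphic function
  of one variable. In the second variable it is a Cauchy integral over a fixed circle, which can be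
  differentiated under the integral sign.\<close>

lemma separately_holomorphic_pd1:
  assumes f: "separately_holomorphic f D" and "open D"
  shows "separately_holomorphic (pd1 f) D"
proof (rule separately_holomorphicI)
  show "continuous_on D (pd1 f)" by (rule continuous_on_pd1) fact+
next
  fix x0 y0 assume "(x0, y0) \<in> D"
  then obtain r where r: "r > 0" "cball x0 r \<times> cball y0 r \<subseteq> D"
    using open_contains_cball_times assms(2) by blast
  have "(\<lambda>t. f (t, y0)) holomorphic_on ball x0 r"
  proof (rule holomorphic_onI)
    fix x assume "x \<in> ball x0 r"
    then have "(x, y0) \<in> D" using r by auto
    then have "((\<lambda>t. f (t, y0)) has_field_derivative pd1 f (x, y0)) (at x)"
      using f by (simp add: separately_holomorphic_def)
    then show "(\<lambda>t. f (t, y0)) field_differentiable at x within ball x0 r"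
      unfolding field_differentiable_def using has_field_derivative_at_within by blast
  qed
  then have "deriv (\<lambda>t. f (t, y0)) holomorphic_on ball x0 r"
    by (rule holomorphic_deriv) simp
  then show "(\<lambda>t. pd1 f (t, y0)) field_differentiable at x0"
    using r by (simp add: pd1_def holomorphic_on_imp_differentiable_at)
  have "(\<lambda>y. integral (cbox 0 1)
     (\<lambda>t. f (circlepath x0 r t, y) / (circlepath x0 r t - x0)\<^sup>2
        * (2 * pi * \<i> * r * exp (2 * of_real pi * \<i> * t)))) holomorphic_on ball y0 r"
  proof (rule leibniz_rule_holomorphic[where fx = "\<lambda>y t. pd2 f (circlepath x0 r t, y) / (circlepath x0 r t - x0)\<^sup>2
        * (2 * pi * \<i> * r * exp (2 * of_real pi * \<i> * t))"])
    fix y t assume y: "y \<in> ball y0 r"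
    then have "(circlepath x0 r t, y) \<in> D"
      using circlepath_in(1)[of r x0 x0 t] r by auto
    then have "((\<lambda>y. f (circlepath x0 r t, y)) has_field_derivative pd2 f (circlepath x0 r t, y)) (at y)"
      using f by (simp add: separately_holomorphic_def)
    then show "((\<lambda>y. f (circlepath x0 r t, y) / (circlepath x0 r t - x0)\<^sup>2
        * (2 * pi * \<i> * r * exp (2 * of_real pi * \<i> * t))) has_field_derivative
        pd2 f (circlepath x0 r t, y) / (circlepath x0 r t - x0)\<^sup>2
        * (2 * pi * \<i> * r * exp (2 * of_real pi * \<i> * t))) (at y within ball y0 r)"
      by (rule DERIV_cmult_right[OF DERIV_cdivide[OF has_field_derivative_at_within]])
  next
    fix y assume y: "y \<in> ball y0 r"
    have "continuous_on (cbox 0 1) (\<lambda>t. (\<lambda>(v, t).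
     f (circlepath x0 r t, snd v) / (circlepath x0 r t - fst v)\<^sup>2
        * (2 * pi * \<i> * r * exp (2 * of_real pi * \<i> * of_real t))) ((x0, y), t))"
      by (rule continuous_on_compose2[OF continuous_on_Cauchy_kernel[OF _ r(2,1)]])
         (use f r y in \<open>simp_all add: separately_holomorphic_def continuous_on_Pair continuous_on_id continuous_on_const image_subset_iff\<close>)
    then show "(\<lambda>t. f (circlepath x0 r t, y) / (circlepath x0 r t - x0)\<^sup>2
        * (2 * pi * \<i> * r * exp (2 * of_real pi * \<i> * t))) integrable_on cbox 0 1"
      by (intro integrable_continuous) simp
  next
    \<comment> \<open>The differentiated integrand is the same kernel with density
      \<open>pd2 f\<close>, whose joint continuity is already known.\<close>
    have "continuous_on (ball y0 r \<times> cbox 0 1) (\<lambda>p. (\<lambda>(v, t).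
     pd2 f (circlepath x0 r t, snd v) / (circlepath x0 r t - fst v)\<^sup>2
        * (2 * pi * \<i> * r * exp (2 * of_real pi * \<i> * of_real t))) ((x0, fst p), snd p))"
      by (rule continuous_on_compose2[OF continuous_on_Cauchy_kernel[OF _ r(2,1)]])
         (use continuous_on_pd2[OF assms] r in \<open>simp_all add: continuous_on_Pair continuous_on_id continuous_on_const continuous_on_fst continuous_on_snd image_subset_iff\<close>)
    then show "continuous_on (ball y0 r \<times> cbox 0 1)
     (\<lambda>(y, t). pd2 f (circlepath x0 r t, y) / (circlepath x0 r t - x0)\<^sup>2 *
               (2 * pi * \<i> * r * exp (2 * of_real pi * \<i> * t)))"
      by (simp add: case_prod_beta)
  qed simp
  then have "(\<lambda>y. 1 / (2 * of_real pi * \<i>) * integral (cbox 0 1)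
     (\<lambda>t. f (circlepath x0 r t, y) / (circlepath x0 r t - x0)\<^sup>2
        * (2 * pi * \<i> * r * exp (2 * of_real pi * \<i> * t)))) holomorphic_on ball y0 r"
    by (intro holomorphic_intros)
  then have "(\<lambda>y. pd1 f (x0, y)) holomorphic_on ball y0 r"
    by (rule holomorphic_transform) (use r in \<open>simp add: pd1_Cauchy_integral[OF f r(2)]\<close>)
  then show "(\<lambda>y. pd1 f (x0, y)) field_differentiable at y0"
    using r by (simp add: holomorphic_on_imp_differentiable_at)
qed

lemma separately_holomorphic_pd2:
  assumes f: "separately_holomorphic f D" and "open D"
  shows "separately_holomorphic (pd2 f) D"
proof -
  have "separately_holomorphic (pd2 f \<circ> prod.swap) (prod.swap ` D)"
    using separately_holomorphic_pd1[OF separately_holomorphic_swap open_swap] assms by (simp add: pd_swap)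
  from separately_holomorphic_swap[OF this] show ?thesis
    by (simp add: image_image comp_assoc)
qed

text \<open>Osgood's lemma. Existence of one partial derivative at the point, together with
  existence nearby and continuity of the other one, gives total differentiability. The second
  partial is packaged as a bounded linear map, the form in which
  \<open>has_derivative_partialsI\<close> expects it.\<close>

lemma separately_holomorphic_imp_holomorphic2:
  assumes f: "separately_holomorphic f D" and "open D"
  shows "f holomorphic2_on D"
  unfolding holomorphic2_on_def
proof clarify
  fix x y assume "(x, y) \<in> D"
  then obtain r where r: "r > 0" "cball x r \<times> cball y r \<subseteq> D"
    using open_contains_cball_times assms(2) by blast
  let ?X = "ball x r" and ?Y = "ball y r"
  have X: "x \<in> ?X" and Y: "y \<in> ?Y" using r by auto
  have sub: "?X \<times> ?Y \<subseteq> D" using r(2) by force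
  have "((\<lambda>(x, y). f (x, y)) has_derivative
     (\<lambda>(tx, ty). pd1 f (x, y) * tx + blinfun_apply (blinfun_mult_right (pd2 f (x, y))) ty)) (at (x, y) within ?X \<times> ?Y)"
  proof (rule has_derivative_partialsI[where f = "\<lambda>x y. f (x, y)" and fx = "\<lambda>tx. pd1 f (x, y) * tx"
        and fy = "\<lambda>x y. blinfun_mult_right (pd2 f (x, y))"])
    show "((\<lambda>x. f (x, y)) has_derivative (*) (pd1 f (x, y))) (at x within ball x r)"
    proof -
      have "((\<lambda>x. f (x, y)) has_field_derivative pd1 f (x, y)) (at x)"
        using f sub X Y unfolding separately_holomorphic_def by blast
      then show ?thesis
        by (simp add: has_field_derivative_def has_derivative_at_withinI)
    qed
    show "((\<lambda>y. f (x', y)) has_derivative blinfun_apply (blinfun_mult_right (pd2 f (x', y')))) (at y' within ball y r)"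
      if "x' \<in> ?X" "y' \<in> ?Y" for x' y'
    proof -
      have "((\<lambda>y. f (x', y)) has_field_derivative pd2 f (x', y')) (at y')"
        using f sub that unfolding separately_holomorphic_def by blast
      then show ?thesis
        by (simp add: has_field_derivative_def has_derivative_at_withinI)
    qed
    have "isCont (pd2 f) (x, y)"
      using continuous_on_pd2[OF assms] \<open>open D\<close> \<open>(x, y) \<in> D\<close>
      by (simp add: continuous_on_eq_continuous_at)
    then have "continuous (at (x, y) within ball x r \<times> ball y r) (pd2 f)"
      by (rule continuous_at_imp_continuous_at_within)
    from bounded_linear.continuous[OF bounded_linear_blinfun_mult_right this]
    show "continuous (at (x, y) within ball x r \<times> ball y r) (\<lambda>(x, y). blinfun_mult_right (pd2 f (x, y)))"
      by (simp add: case_prod_unfold)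
  qed (use Y in auto)
  moreover have "at (x, y) within ?X \<times> ?Y = at (x, y)"
    by (rule at_within_open) (use X Y in \<open>simp_all add: open_Times\<close>)
  ultimately have "(f has_derivative (\<lambda>(h, k). pd1 f (x, y) * h + pd2 f (x, y) * k)) (at (x, y))"
    by simp
  then have "(f has_derivative (\<lambda>(h, k). pd1 f (x, y) * h + pd2 f (x, y) * k)) (at (x, y) within D)"
    by (rule has_derivative_at_withinI)
  then show "\<exists>a b. (f has_derivative (\<lambda>(h, k). a * h + b * k)) (at (x, y) within D)"
    by (intro exI)
qed

lemma holomorphic2_imp_separately_holomorphic:
  "f holomorphic2_on D \<Longrightarrow> open D \<Longrightarrow> separately_holomorphic f D"
  by (simp add: separately_holomorphic_def holomorphic2_imp_continuous_on holomorphic2_partials)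

lemma holomorphic2_pd:
  assumes "f holomorphic2_on D" "open D"
  shows "pd1 f holomorphic2_on D" "pd2 f holomorphic2_on D"
  using separately_holomorphic_imp_holomorphic2[OF separately_holomorphic_pd1]
    separately_holomorphic_imp_holomorphic2[OF separately_holomorphic_pd2]
    holomorphic2_imp_separately_holomorphic assms by simp_all

section \<open>Rules for partial derivatives, and branches of powers\<close>

lemma pd_eqI:
  assumes "(f has_derivative (\<lambda>(h, k). a * h + b * k)) (at v)"
  shows "pd1 f v = a" "pd2 f v = b"
proof -
  obtain x y where v: "v = (x, y)" by (cases v)
  show "pd1 f v = a" "pd2 f v = b"
    using has_derivative_imp_partials[of f a b x y, THEN DERIV_imp_deriv] assms
    by (simp_all add: v pd1_def pd2_def)
qed

lemma holomorphic2_onI: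
  assumes "\<And>v. v \<in> D \<Longrightarrow> (f has_derivative (\<lambda>(h, k). a v * h + b v * k)) (at v)"
  shows "f holomorphic2_on D"
  unfolding holomorphic2_on_def using assms has_derivative_at_withinI by blast

lemma holomorphic2_derivative:
  assumes "f holomorphic2_on D" "open D" "v \<in> D"
  shows "(f has_derivative (\<lambda>(h, k). pd1 f v * h + pd2 f v * k)) (at v)"
proof -
  obtain a b where "(f has_derivative (\<lambda>(h, k). a * h + b * k)) (at v)"
    using holomorphic2_has_derivative[OF assms] .
  with pd_eqI[OF this] show ?thesis by simp
qed

lemma
  assumes "\<And>v. v \<in> D \<Longrightarrow> f v = g v" "open D" "v \<in> D"
  shows pd1_cong: "pd1 f v = pd1 g v" and pd2_cong: "pd2 f v = pd2 g v"
proof -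
  obtain x y where v: "v = (x, y)" by (cases v)
  obtain r where r: "r > 0" "cball x r \<times> cball y r \<subseteq> D"
    using open_contains_cball_times assms(2,3) unfolding v by blast
  have "\<forall>\<^sub>F t in nhds x. f (t, y) = g (t, y)"
    by (rule eventually_nhds_in_open[of "ball x r", THEN eventually_mono]) (use r assms(1) in \<open>auto simp: subset_iff\<close>)
  moreover have "\<forall>\<^sub>F t in nhds y. f (x, t) = g (x, t)"
    by (rule eventually_nhds_in_open[of "ball y r", THEN eventually_mono]) (use r assms(1) in \<open>auto simp: subset_iff\<close>)
  ultimately show "pd1 f v = pd1 g v" "pd2 f v = pd2 g v"
    by (simp_all add: v pd1_def pd2_def deriv_cong_ev)
qed

lemma holomorphic2_cong:
  assumes "f holomorphic2_on D" "\<And>v. v \<in> D \<Longrightarrow> g v = f v"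
  shows "g holomorphic2_on D"
  using assms unfolding holomorphic2_on_def by (metis has_derivative_transform)

lemma
  assumes "f holomorphic2_on D" "g holomorphic2_on D" "open D"
  shows holomorphic2_add: "(\<lambda>v. f v + g v) holomorphic2_on D"
    and pd1_add: "v \<in> D \<Longrightarrow> pd1 (\<lambda>v. f v + g v) v = pd1 f v + pd1 g v"
    and pd2_add: "v \<in> D \<Longrightarrow> pd2 (\<lambda>v. f v + g v) v = pd2 f v + pd2 g v"
proof -
  have *: "((\<lambda>v. f v + g v) has_derivative
     (\<lambda>(h, k). (pd1 f v + pd1 g v) * h + (pd2 f v + pd2 g v) * k)) (at v)" if "v \<in> D" for v
    by (rule has_derivative_eq_rhs[OF has_derivative_add[OF
          holomorphic2_derivative[OF assms(1,3) that] holomorphic2_derivative[OF assms(2,3) that]]])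
       (auto simp: fun_eq_iff algebra_simps)
  show "(\<lambda>v. f v + g v) holomorphic2_on D" by (rule holomorphic2_onI[OF *])
  show "v \<in> D \<Longrightarrow> pd1 (\<lambda>v. f v + g v) v = pd1 f v + pd1 g v"
    "v \<in> D \<Longrightarrow> pd2 (\<lambda>v. f v + g v) v = pd2 f v + pd2 g v" by (simp_all add: pd_eqI[OF *])
qed

lemma
  assumes "f holomorphic2_on D" "g holomorphic2_on D" "open D"
  shows holomorphic2_mult: "(\<lambda>v. f v * g v) holomorphic2_on D"
    and pd1_mult: "v \<in> D \<Longrightarrow> pd1 (\<lambda>v. f v * g v) v = pd1 f v * g v + f v * pd1 g v"
    and pd2_mult: "v \<in> D \<Longrightarrow> pd2 (\<lambda>v. f v * g v) v = pd2 f v * g v + f v * pd2 g v"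
proof -
  have *: "((\<lambda>v. f v * g v) has_derivative
     (\<lambda>(h, k). (pd1 f v * g v + f v * pd1 g v) * h + (pd2 f v * g v + f v * pd2 g v) * k)) (at v)"
    if "v \<in> D" for v
    by (rule has_derivative_eq_rhs[OF has_derivative_mult[OF
          holomorphic2_derivative[OF assms(1,3) that] holomorphic2_derivative[OF assms(2,3) that]]])
       (auto simp: fun_eq_iff algebra_simps)
  show "(\<lambda>v. f v * g v) holomorphic2_on D" by (rule holomorphic2_onI[OF *])
  show "v \<in> D \<Longrightarrow> pd1 (\<lambda>v. f v * g v) v = pd1 f v * g v + f v * pd1 g v"
    "v \<in> D \<Longrightarrow> pd2 (\<lambda>v. f v * g v) v = pd2 f v * g v + f v * pd2 g v" by (simp_all add: pd_eqI[OF *])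
qed

lemma holomorphic2_const: "(\<lambda>v. c) holomorphic2_on D"
  by (rule holomorphic2_onI[where a="\<lambda>_. 0" and b="\<lambda>_. 0"]) (simp add: case_prod_unfold)

lemma pd_const: "pd1 (\<lambda>v. c) v = 0" "pd2 (\<lambda>v. c) v = 0"
  by (auto simp: pd1_def pd2_def split: prod.split)

text \<open>Logarithmic partial derivatives, written without a division by \<open>u\<close>.
  Multiplying functions adds them, so a product of powers can be treated factor by factor.\<close>

definition has_log_partials where
  "has_log_partials u A B D \<longleftrightarrow> u holomorphic2_on D \<and>
     (\<forall>v\<in>D. pd1 u v = A v * u v \<and> pd2 u v = B v * u v)"

lemma has_log_partials_mult:
  assumes "has_log_partials u A B D" "has_log_partials u' A' B' D" "open D"
  shows "has_log_partials (\<lambda>v. u v * u' v) (\<lambda>v. A v + A' v) (\<lambda>v. B v + B' v) D"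
  using assms unfolding has_log_partials_def
  by (auto simp: holomorphic2_mult pd1_mult pd2_mult algebra_simps)

text \<open>The logarithm \<open>L\<close> in a power branch is merely continuous. Near a point
  \<open>v0\<close> it must coincide with \<open>L v0 + Ln (g v / g v0)\<close>, so that the branch
  is locally a holomorphic function \<open>F\<close> of \<open>g\<close>, and the chain rule
  applies.\<close>

lemma power_branch_has_log_partials:
  assumes p: "power_branch D g s p" and g: "g holomorphic2_on D" and "open D"
  shows "has_log_partials p (\<lambda>v. s * pd1 g v / g v) (\<lambda>v. s * pd2 g v / g v) D"
proof -
  from p obtain L where L: "continuous_on D L" "\<And>v. v \<in> D \<Longrightarrow> exp (L v) = g v"
    "\<And>v. v \<in> D \<Longrightarrow> p v = exp (s * L v)"
    unfolding power_branch_def by blast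
  have *: "(p has_derivative (\<lambda>(h, k). (s * pd1 g v0 / g v0 * p v0) * h + (s * pd2 g v0 / g v0 * p v0) * k)) (at v0)"
    if v0: "v0 \<in> D" for v0
  proof -
    define F where "F \<zeta> = exp (s * (L v0 + Ln (\<zeta> / g v0)))" for \<zeta>
    have gv0: "g v0 \<noteq> 0" using L(2)[OF v0] exp_not_eq_zero by metis
    have "(F has_field_derivative s / g v0 * p v0) (at (g v0))"
      unfolding F_def
      by (rule derivative_eq_intros refl | use gv0 L(3)[OF v0] in simp)+
    then have "(F has_derivative (*) (s / g v0 * p v0)) (at (g v0))"
      by (simp add: has_field_derivative_def)
    then have "((\<lambda>v. F (g v)) has_derivative (\<lambda>h. (s / g v0 * p v0) *
        (case h of (h, k) \<Rightarrow> pd1 g v0 * h + pd2 g v0 * k))) (at v0)"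
      using has_derivative_compose[OF holomorphic2_derivative[OF g \<open>open D\<close> v0]] by blast
    moreover have "(\<lambda>h. (s / g v0 * p v0) * (case h of (h, k) \<Rightarrow> pd1 g v0 * h + pd2 g v0 * k)) =
       (\<lambda>(h, k). (s * pd1 g v0 / g v0 * p v0) * h + (s * pd2 g v0 / g v0 * p v0) * k)"
      by (auto simp: fun_eq_iff algebra_simps add_divide_distrib)
    ultimately have "((\<lambda>v. F (g v)) has_derivative
       (\<lambda>(h, k). (s * pd1 g v0 / g v0 * p v0) * h + (s * pd2 g v0 / g v0 * p v0) * k)) (at v0)" by simp
    moreover have "open (D \<inter> L -` ball (L v0) 1)"
      using L(1) \<open>open D\<close> by (simp add: continuous_open_preimage)
    moreover have "v0 \<in> D \<inter> L -` ball (L v0) 1" using v0 by simp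
    moreover have "F (g v) = p v" if "v \<in> D \<inter> L -` ball (L v0) 1" for v
    proof -
      \<comment> \<open>The radius 1 is smaller than pi, which puts \<open>L v - L v0\<close> in the
        strip where \<open>Ln\<close> inverts \<open>exp\<close>.\<close>
      have "\<bar>Im (L v - L v0)\<bar> < 1"
        using that abs_Im_le_cmod[of "L v - L v0"] by (auto simp: dist_norm norm_minus_commute)
      then have "Ln (exp (L v - L v0)) = L v - L v0"
        using pi_gt3 by (intro Ln_exp) auto
      then show ?thesis using that L(2)[OF v0] L(2)[of v] L(3)[of v]
        by (simp add: F_def exp_diff)
    qed
    ultimately show ?thesis by (rule has_derivative_transform_within_open)
  qed
  show ?thesis unfolding has_log_partials_def
    using holomorphic2_onI[OF *] pd_eqI[OF *] by blast
qed

lemma holomorphic2_linear: "(\<lambda>(v1, v2). a * v1 + b * v2 + c) holomorphic2_on D"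
  and pd1_linear: "pd1 (\<lambda>(v1, v2). a * v1 + b * v2 + c) v = a"
  and pd2_linear: "pd2 (\<lambda>(v1, v2). a * v1 + b * v2 + c) v = b"
proof -
  have *: "((\<lambda>(v1, v2). a * v1 + b * v2 + c) has_derivative (\<lambda>(h, k). a * h + b * k)) (at v)" for v
    unfolding case_prod_beta by (auto intro!: derivative_eq_intros)
  show "(\<lambda>(v1, v2). a * v1 + b * v2 + c) holomorphic2_on D"
    by (rule holomorphic2_onI[OF *])
  show "pd1 (\<lambda>(v1, v2). a * v1 + b * v2 + c) v = a" "pd2 (\<lambda>(v1, v2). a * v1 + b * v2 + c) v = b"
    using pd_eqI[OF *] by auto
qed

lemma power_product_log_partials:
  assumes "open D"
    and "power_branch D (\<lambda>(v1, v2). v1) a p1" "power_branch D (\<lambda>(v1, v2). v2) a p2"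
    and "power_branch D (\<lambda>(v1, v2). v1 - 1) b p3" "power_branch D (\<lambda>(v1, v2). v2 - 1) b p4"
    and "power_branch D (\<lambda>(v1, v2). v1 - v2) c p5"
    and ne: "\<And>v1 v2. (v1, v2) \<in> D \<Longrightarrow> v1 \<noteq> v2"
  shows "has_log_partials (\<lambda>v. p1 v * p2 v * p3 v * p4 v * p5 v) (coeff_P1 a b c) (coeff_P2 a b c) D"
proof -
  \<comment> \<open>All five bases are affine functions, so one computation with free coefficients
    covers them.\<close>
  have *: "has_log_partials p (\<lambda>(v1, v2). s * k / (k * v1 + l * v2 + m)) (\<lambda>(v1, v2). s * l / (k * v1 + l * v2 + m)) D"
    if "power_branch D (\<lambda>(v1, v2). k * v1 + l * v2 + m) s p" for p s k l m
    using power_branch_has_log_partials[OF that holomorphic2_linear \<open>open D\<close>]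
    unfolding pd1_linear pd2_linear by (simp add: case_prod_unfold)
  note 1 = *[where k=1 and l=0 and m=0, simplified, OF assms(2)]
  note 2 = *[where k=0 and l=1 and m=0, simplified, OF assms(3)]
  note 3 = *[where k=1 and l=0 and m="-1", simplified, OF assms(4)]
  note 4 = *[where k=0 and l=1 and m="-1", simplified, OF assms(5)]
  note 5 = *[where k=1 and l="-1" and m=0, simplified, OF assms(6)]
  note m = has_log_partials_mult[OF _ _ \<open>open D\<close>]
  \<comment> \<open>Differentiating the power of \<open>v1 - v2\<close> in \<open>v2\<close> gives
    the left form, whereas \<open>coeff_P2\<close> is written with \<open>v2 - v1\<close>.\<close>
  have eq: "- (c / (x - y)) = c / (y - x)" for x y :: complex
    by (metis minus_diff_eq minus_divide_right)
  from m[OF m[OF m[OF m[OF 1 2] 3] 4] 5] show ?thesis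
    by (simp add: case_prod_unfold coeff_P1_def coeff_P2_def eq)
qed

section \<open>Change of the dependent variable\<close>

text \<open>The product rule applied twice. The first-order formulas hold only on \<open>D\<close>;
  as \<open>D\<close> is open, \<open>pd1_cong\<close> and \<open>pd2_cong\<close> allow
  substituting them under the second derivative.\<close>

lemma gauge_transform:
  assumes u: "has_log_partials u A B D" and hol: "A holomorphic2_on D" "B holomorphic2_on D" "z holomorphic2_on D"
    and "open D"
  defines "w \<equiv> \<lambda>v. u v * z v"
  shows "w holomorphic2_on D"
    and "v \<in> D \<Longrightarrow> pd1 w v = u v * (pd1 z v + A v * z v)"
    and "v \<in> D \<Longrightarrow> pd2 w v = u v * (pd2 z v + B v * z v)"
    and "v \<in> D \<Longrightarrow> pd1 (pd1 w) v = u v * (pd1 (pd1 z) v + 2 * A v * pd1 z v + (pd1 A v + (A v)\<^sup>2) * z v)"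
    and "v \<in> D \<Longrightarrow> pd2 (pd2 w) v = u v * (pd2 (pd2 z) v + 2 * B v * pd2 z v + (pd2 B v + (B v)\<^sup>2) * z v)"
    and "v \<in> D \<Longrightarrow> pd1 (pd2 w) v =
           u v * (pd1 (pd2 z) v + B v * pd1 z v + A v * pd2 z v + (pd1 B v + A v * B v) * z v)"
proof -
  have hu: "u holomorphic2_on D" and pu: "\<And>v. v \<in> D \<Longrightarrow> pd1 u v = A v * u v" "\<And>v. v \<in> D \<Longrightarrow> pd2 u v = B v * u v"
    using u by (auto simp: has_log_partials_def)
  show "w holomorphic2_on D"
    unfolding w_def by (intro holomorphic2_mult hu hol \<open>open D\<close>)
  show w1: "pd1 w v = u v * (pd1 z v + A v * z v)" if "v \<in> D" for v
    using that hu hol \<open>open D\<close> pu by (simp add: w_def pd1_mult algebra_simps)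
  show w2: "pd2 w v = u v * (pd2 z v + B v * z v)" if "v \<in> D" for v
    using that hu hol \<open>open D\<close> pu by (simp add: w_def pd2_mult algebra_simps)
  note h = hol hu holomorphic2_pd[OF _ \<open>open D\<close>] holomorphic2_add[OF _ _ \<open>open D\<close>] holomorphic2_mult[OF _ _ \<open>open D\<close>]
  note pd = pd1_mult[OF _ _ \<open>open D\<close>] pd2_mult[OF _ _ \<open>open D\<close>] pd1_add[OF _ _ \<open>open D\<close>] pd2_add[OF _ _ \<open>open D\<close>]
  show "pd1 (pd1 w) v = u v * (pd1 (pd1 z) v + 2 * A v * pd1 z v + (pd1 A v + (A v)\<^sup>2) * z v)" if "v \<in> D"
  proof -
    have "pd1 (pd1 w) v = pd1 (\<lambda>v. u v * (pd1 z v + A v * z v)) v"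
      by (rule pd1_cong[OF w1 \<open>open D\<close> that])
    then show ?thesis using that
        by (simp add: h pd pu) (simp add: algebra_simps power2_eq_square)
  qed
  show "pd2 (pd2 w) v = u v * (pd2 (pd2 z) v + 2 * B v * pd2 z v + (pd2 B v + (B v)\<^sup>2) * z v)" if "v \<in> D"
  proof -
    have "pd2 (pd2 w) v = pd2 (\<lambda>v. u v * (pd2 z v + B v * z v)) v"
      by (rule pd2_cong[OF w2 \<open>open D\<close> that])
    then show ?thesis using that
        by (simp add: h pd pu) (simp add: algebra_simps power2_eq_square)
  qed
  show "pd1 (pd2 w) v =
           u v * (pd1 (pd2 z) v + B v * pd1 z v + A v * pd2 z v + (pd1 B v + A v * B v) * z v)" if "v \<in> D"
  proof -
    have "pd1 (pd2 w) v = pd1 (\<lambda>v. u v * (pd2 z v + B v * z v)) v"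
      by (rule pd1_cong[OF w2 \<open>open D\<close> that])
    then show ?thesis using that
        by (simp add: h pd pu) (simp add: algebra_simps)
  qed
qed

section \<open>The rational coefficients of the two systems off their poles\<close>

definition nonsingular :: "(complex \<times> complex) set \<Rightarrow> bool" where
  "nonsingular D \<longleftrightarrow> (\<forall>(v1, v2)\<in>D. v1 \<noteq> 0 \<and> v1 \<noteq> 1 \<and> v2 \<noteq> 0 \<and> v2 \<noteq> 1 \<and> v1 \<noteq> v2)"

lemma coeff_P_holomorphic2:
  assumes "nonsingular D" "open D"
  shows "coeff_P1 a b c holomorphic2_on D" "coeff_P2 a b c holomorphic2_on D"
proof -
  have ne: "v1 \<noteq> 0 \<and> v1 \<noteq> 1 \<and> v2 \<noteq> 0 \<and> v2 \<noteq> 1 \<and> v1 \<noteq> v2" if "(v1, v2) \<in> D" for v1 v2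
    using assms(1) that by (auto simp: nonsingular_def)
  have "continuous_on D (\<lambda>v. a / fst v + b / (fst v - 1) + c / (fst v - snd v))"
    "continuous_on D (\<lambda>v. a / snd v + b / (snd v - 1) + c / (snd v - fst v))"
    by (intro continuous_intros; use ne in force)+
  then show "coeff_P1 a b c holomorphic2_on D" "coeff_P2 a b c holomorphic2_on D"
    using assms(2) ne ne[of x x for x]
    by (auto intro!: separately_holomorphic_imp_holomorphic2 separately_holomorphicI derivative_intros
        simp: coeff_P1_def coeff_P2_def case_prod_unfold)
qed

lemma
  assumes "v1 \<noteq> 0" "v1 \<noteq> 1" "v2 \<noteq> 0" "v2 \<noteq> 1" "v1 \<noteq> v2"
  shows pd1_coeff_P1: "pd1 (coeff_P1 a b c) (v1, v2) = - a / v1\<^sup>2 - b / (v1 - 1)\<^sup>2 - c / (v1 - v2)\<^sup>2"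
    and pd2_coeff_P1: "pd2 (coeff_P1 a b c) (v1, v2) = c / (v1 - v2)\<^sup>2"
    and pd1_coeff_P2: "pd1 (coeff_P2 a b c) (v1, v2) = c / (v1 - v2)\<^sup>2"
    and pd2_coeff_P2: "pd2 (coeff_P2 a b c) (v1, v2) = - a / v2\<^sup>2 - b / (v2 - 1)\<^sup>2 - c / (v1 - v2)\<^sup>2"
    and pd2_coeff_F1: "pd2 (coeff_F1 c) (v1, v2) =
          - c * ((2 * v2 - 1) / (v1 - v2) + v2 * (v2 - 1) / (v1 - v2)\<^sup>2) / (v1 * (v1 - 1))"
    and pd1_coeff_F2: "pd1 (coeff_F2 c) (v1, v2) =
          - c * ((2 * v1 - 1) / (v2 - v1) + v1 * (v1 - 1) / (v1 - v2)\<^sup>2) / (v2 * (v2 - 1))"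
proof -
  have ne: "v1 - 1 \<noteq> 0" "v2 - 1 \<noteq> 0" "v1 - v2 \<noteq> 0" "v2 - v1 \<noteq> 0" using assms by auto
  \<comment> \<open>The functions with denominator \<open>v2 - v1\<close> produce squares of that
    difference when differentiated; this matches them with the stated form.\<close>
  have sq: "(v1 - v2)\<^sup>2 = (v2 - v1) * (v2 - v1)" by (simp add: power2_eq_square algebra_simps)
  show "pd1 (coeff_P1 a b c) (v1, v2) = - a / v1\<^sup>2 - b / (v1 - 1)\<^sup>2 - c / (v1 - v2)\<^sup>2"
    unfolding pd1_def coeff_P1_def prod.case
    by (rule DERIV_imp_deriv) (use assms in \<open>auto intro!: derivative_eq_intros simp: power2_eq_square\<close>)
  show "pd2 (coeff_P1 a b c) (v1, v2) = c / (v1 - v2)\<^sup>2"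
    unfolding pd2_def coeff_P1_def prod.case
    by (rule DERIV_imp_deriv) (use assms in \<open>auto intro!: derivative_eq_intros simp: power2_eq_square\<close>)
  show "pd1 (coeff_P2 a b c) (v1, v2) = c / (v1 - v2)\<^sup>2"
    unfolding pd1_def coeff_P2_def prod.case sq
    by (rule DERIV_imp_deriv) (use assms in \<open>auto intro!: derivative_eq_intros simp: power2_eq_square\<close>)
  show "pd2 (coeff_P2 a b c) (v1, v2) = - a / v2\<^sup>2 - b / (v2 - 1)\<^sup>2 - c / (v1 - v2)\<^sup>2"
    unfolding pd2_def coeff_P2_def prod.case sq
    by (rule DERIV_imp_deriv) (use assms in \<open>auto intro!: derivative_eq_intros simp: power2_eq_square\<close>)
  show "pd2 (coeff_F1 c) (v1, v2) =
          - c * ((2 * v2 - 1) / (v1 - v2) + v2 * (v2 - 1) / (v1 - v2)\<^sup>2) / (v1 * (v1 - 1))"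
    unfolding pd2_def coeff_F1_def prod.case
    by (rule DERIV_imp_deriv, (rule derivative_eq_intros refl)+; (use assms in \<open>simp; fail\<close>)?)
       (use ne assms in \<open>simp add: divide_simps power2_eq_square; simp add: algebra_simps\<close>)
  show "pd1 (coeff_F2 c) (v1, v2) =
          - c * ((2 * v1 - 1) / (v2 - v1) + v1 * (v1 - 1) / (v1 - v2)\<^sup>2) / (v2 * (v2 - 1))"
    unfolding pd1_def coeff_F2_def prod.case sq
    by (rule DERIV_imp_deriv, (rule derivative_eq_intros refl)+; (use assms in \<open>simp; fail\<close>)?)
       (use ne assms in \<open>simp add: divide_simps power2_eq_square; simp add: algebra_simps\<close>)
qed

text \<open>The zero-order coefficient of the first equation after the change of variable. The
  letters \<open>i, j, k, l, m\<close> are the reciprocals of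
  \<open>x, x - 1, x - y, y, y - 1\<close>, so the claim is a polynomial identity modulo five
  relations. In this form it also covers the second equation, by exchanging \<open>x\<close> and
  \<open>y\<close> and replacing \<open>k\<close> by \<open>-k\<close>.\<close>

lemma diag_identity:
  fixes x y \<alpha> \<beta> \<gamma> i j k l m :: complex
  assumes "x * i = 1" "(x - 1) * j = 1" "(x - y) * k = 1" "y * l = 1" "(y - 1) * m = 1"
  shows "(1 - \<alpha> - \<beta>) * \<gamma> * i * j =
      (- \<gamma> * ((2 * y - 1) * k + y * (y - 1) * k\<^sup>2) * i * j - 1/3 * (- (\<alpha> * i\<^sup>2 + \<beta> * j\<^sup>2 + \<gamma> * k\<^sup>2))
        - 2/9 * (\<alpha> * i + \<beta> * j + \<gamma> * k)\<^sup>2 - 2/3 * (- (\<gamma> * y * (y - 1) * i * j * k)) * (\<alpha> * l + \<beta> * m - \<gamma> * k))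
      - ((\<alpha> * i\<^sup>2 + \<beta> * j\<^sup>2 - 2 * \<gamma> * k\<^sup>2) / 3 + ((- \<alpha> * i - \<beta> * j + 2 * \<gamma> * k) / 3)\<^sup>2)
      - (\<alpha> * i + \<beta> * j - \<gamma> * k) * ((- \<alpha> * i - \<beta> * j + 2 * \<gamma> * k) / 3)
      + (- (\<gamma> * y * (y - 1) * i * j * k)) * ((- \<alpha> * l - \<beta> * m - 2 * \<gamma> * k) / 3)"
    (is "?L = ?R")
proof -
  \<comment> \<open>Together with the next two facts, this rewrites every remaining term as a
    multiple of \<open>i * j\<close>, that is, over the denominator \<open>x (x - 1)\<close>. Here
    the numerator is split as \<open>x - 1 = (x - y) + (y - 1)\<close>, below as
    \<open>x = (x - y) + y\<close>.\<close>
  have a: "i * k = i * j * k * (y - 1) + i * j"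
  proof -
    have "i * k = i * k * ((x - 1) * j)" using assms(2) by simp
    also have "\<dots> = i * j * ((x - y) * k) + i * j * k * (y - 1)" by (simp add: algebra_simps)
    finally show ?thesis using assms(3) by simp
  qed
  have b: "j * k = i * j * k * y + i * j"
  proof -
    have "j * k = j * k * (x * i)" using assms(1) by simp
    also have "\<dots> = i * j * ((x - y) * k) + i * j * k * y" by (simp add: algebra_simps)
    finally show ?thesis using assms(3) by simp
  qed
  \<comment> \<open>The Taylor expansion of \<open>x (x - 1)\<close> about \<open>y\<close>, divided
    by \<open>x (x - 1) (x - y)^2\<close>.\<close>
  have c: "k\<^sup>2 = i * j + (2 * y - 1) * k * i * j + y * (y - 1) * k\<^sup>2 * i * j"
  proof -
    have "k\<^sup>2 = k\<^sup>2 * (x * i) * ((x - 1) * j)" using assms(1,2) by simp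
    also have "\<dots> = i * j * ((x - y) * k)\<^sup>2 + (2 * y - 1) * k * i * j * ((x - y) * k) + y * (y - 1) * k\<^sup>2 * i * j"
      by (simp add: algebra_simps power2_eq_square)
    finally show ?thesis using assms(3) by simp
  qed
  have "\<gamma> * y * (y - 1) * i * j * k * (\<alpha> * l + \<beta> * m) =
      \<gamma> * i * j * k * (\<alpha> * (y * l) * (y - 1) + \<beta> * y * ((y - 1) * m))"
    by (simp add: algebra_simps)
  then have F: "\<gamma> * y * (y - 1) * i * j * k * (\<alpha> * l + \<beta> * m) = \<gamma> * i * j * k * (\<alpha> * (y - 1) + \<beta> * y)"
    using assms(4,5) by simp
  \<comment> \<open>The squares of the logarithmic derivatives cancel identically, without the five
    relations; only these terms require them.\<close>
  have "?L - ?R = \<gamma> * \<alpha> * (i * k) + \<gamma> * \<beta> * (j * k) - \<gamma> * k\<^sup>2 + (1 - \<alpha> - \<beta>) * \<gamma> * i * j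
     + \<gamma> * ((2 * y - 1) * k + y * (y - 1) * k\<^sup>2) * i * j
     - \<gamma> * y * (y - 1) * i * j * k * (\<alpha> * l + \<beta> * m)"
    by (simp add: field_simps power2_eq_square)
  also have "\<dots> = 0"
    unfolding F a b by (subst c) (simp add: algebra_simps)
  finally show ?thesis by simp
qed

text \<open>The five relations are needed only to see that
  \<open>F1 F2 = -\<gamma>^2 / (x - y)^2\<close>: all other factors of the two coefficients cancel
  in pairs.\<close>

lemma mixed_identity:
  fixes x y \<alpha> \<beta> \<gamma> i j k l m :: complex
  assumes "x * i = 1" "(x - 1) * j = 1" "(x - y) * k = 1" "y * l = 1" "(y - 1) * m = 1"
  shows "1/3 * (\<gamma> * k\<^sup>2) + 1/3 * (\<gamma> * k\<^sup>2) + 1/9 * (\<alpha> * i + \<beta> * j + \<gamma> * k) * (\<alpha> * l + \<beta> * m - \<gamma> * k)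
      - (- (\<gamma> * y * (y - 1) * i * j * k)) * (\<gamma> * x * (x - 1) * l * m * k) =
      2 * \<gamma> * k\<^sup>2 / 3 + ((- \<alpha> * i - \<beta> * j + 2 * \<gamma> * k) / 3) * ((- \<alpha> * l - \<beta> * m - 2 * \<gamma> * k) / 3)
      + \<gamma> * k * ((- \<alpha> * i - \<beta> * j + 2 * \<gamma> * k) / 3) - \<gamma> * k * ((- \<alpha> * l - \<beta> * m - 2 * \<gamma> * k) / 3)"
    (is "?L = ?R")
proof -
  have "(\<gamma> * y * (y - 1) * i * j * k) * (\<gamma> * x * (x - 1) * l * m * k) =
      \<gamma>\<^sup>2 * k\<^sup>2 * (x * i) * ((x - 1) * j) * (y * l) * ((y - 1) * m)"
    by (simp add: algebra_simps power2_eq_square)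
  then have "(\<gamma> * y * (y - 1) * i * j * k) * (\<gamma> * x * (x - 1) * l * m * k) = \<gamma>\<^sup>2 * k\<^sup>2"
    using assms by simp
  note F = this
  have "?L - ?R = (\<gamma> * y * (y - 1) * i * j * k) * (\<gamma> * x * (x - 1) * l * m * k) - \<gamma>\<^sup>2 * k\<^sup>2"
    by (simp add: field_simps power2_eq_square)
  also have "\<dots> = 0" unfolding F by simp
  finally show ?thesis by (simp only: right_minus_eq)
qed

text \<open>Comparison of coefficients. Substituting \<open>w = u z\<close> in an equation
  \<open>w_11 + p w_1 + q w_2 + s w = 0\<close> and dividing by \<open>u\<close> leaves
  \<open>2 A + p\<close>, \<open>q\<close> and \<open>pd1 A + A^2 + p A + q B + s\<close> as
  coefficients of \<open>z_1\<close>, \<open>z_2\<close> and \<open>z\<close>. Equating these with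
  the \<open>z\<close>-system and solving for \<open>p, q, s\<close> gives the right-hand sides; the
  second and the mixed equation are handled alike.\<close>

lemma system_coefficients:
  fixes x y \<alpha> \<beta> \<gamma> :: complex
  assumes "x \<noteq> 0" "x \<noteq> 1" "y \<noteq> 0" "y \<noteq> 1" "x \<noteq> y"
  defines "v \<equiv> (x, y)"
    and "A \<equiv> coeff_P1 (- \<alpha> / 3) (- \<beta> / 3) (2 * \<gamma> / 3)" and "B \<equiv> coeff_P2 (- \<alpha> / 3) (- \<beta> / 3) (2 * \<gamma> / 3)"
    and "P1 \<equiv> coeff_P1 \<alpha> \<beta> \<gamma>" and "P2 \<equiv> coeff_P2 \<alpha> \<beta> \<gamma>"
    and "F1 \<equiv> coeff_F1 \<gamma>" and "F2 \<equiv> coeff_F2 \<gamma>"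
  shows "\<alpha> / x + \<beta> / (x - 1) + (- \<gamma>) / (x - y) = 1/3 * P1 v - 2 * A v"
    and "\<alpha> / y + \<beta> / (y - 1) + (- \<gamma>) / (y - x) = 1/3 * P2 v - 2 * B v"
    and "\<gamma> * y * (y - 1) / (x * (x - 1) * (x - y)) = - F1 v"
    and "\<gamma> * x * (x - 1) / (y * (y - 1) * (y - x)) = - F2 v"
    and "1/3 * P1 v = \<gamma> / (x - y) - A v" and "1/3 * P2 v = - B v - \<gamma> / (x - y)"
    and "(1 - \<alpha> - \<beta>) * \<gamma> / (x * (x - 1)) =
      (pd2 F1 v - 1/3 * pd1 P1 v - 2/9 * (P1 v)\<^sup>2 - 2/3 * F1 v * P2 v)
      - (pd1 A v + (A v)\<^sup>2) - (1/3 * P1 v - 2 * A v) * A v + F1 v * B v"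
    and "(1 - \<alpha> - \<beta>) * \<gamma> / (y * (y - 1)) =
      (pd1 F2 v - 1/3 * pd2 P2 v - 2/9 * (P2 v)\<^sup>2 - 2/3 * F2 v * P1 v)
      - (pd2 B v + (B v)\<^sup>2) - (1/3 * P2 v - 2 * B v) * B v + F2 v * A v"
    and "1/3 * pd1 P2 v + 1/3 * pd2 P1 v + 1/9 * P1 v * P2 v - F1 v * F2 v =
      pd1 B v + A v * B v + \<gamma> / (x - y) * A v - \<gamma> / (x - y) * B v"
proof -
  define i where "i = inverse x"
  define j where "j = inverse (x - 1)"
  define k where "k = inverse (x - y)"
  define l where "l = inverse y"
  define m where "m = inverse (y - 1)"
  have r: "x * i = 1" "(x - 1) * j = 1" "(x - y) * k = 1" "y * l = 1" "(y - 1) * m = 1" "(y - x) * (- k) = 1"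
    using assms(1-5) by (simp_all add: i_def j_def k_def l_def m_def) (simp add: field_simps)
  \<comment> \<open>With this, the five reciprocals also express the coefficients whose denominator
    contains \<open>y - x\<close>.\<close>
  have k': "inverse (y - x) = - k" using r(6) by (metis inverse_unique)
  have d: "c / x = c * i" "c / (x - 1) = c * j" "c / (x - y) = c * k" "c / y = c * l" "c / (y - 1) = c * m"
    "c / (y - x) = - c * k" "c / x\<^sup>2 = c * i\<^sup>2" "c / (x - 1)\<^sup>2 = c * j\<^sup>2" "c / (x - y)\<^sup>2 = c * k\<^sup>2"
    "c / y\<^sup>2 = c * l\<^sup>2" "c / (y - 1)\<^sup>2 = c * m\<^sup>2"
    "c / (x * (x - 1)) = c * i * j" "c / (x * (x - 1) * (x - y)) = c * i * j * k"
    "c / (y * (y - 1)) = c * l * m" "c / (y * (y - 1) * (y - x)) = - c * l * m * k" for c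
    unfolding divide_inverse power2_eq_square inverse_mult_distrib k'
    by (simp_all add: i_def j_def k_def l_def m_def)
  note pd = pd1_coeff_P1[OF assms(1-5)] pd2_coeff_P1[OF assms(1-5)] pd1_coeff_P2[OF assms(1-5)]
    pd2_coeff_P2[OF assms(1-5)] pd2_coeff_F1[OF assms(1-5)] pd1_coeff_F2[OF assms(1-5)]
  have A: "A v = (- \<alpha> * i - \<beta> * j + 2 * \<gamma> * k) / 3" "B v = (- \<alpha> * l - \<beta> * m - 2 * \<gamma> * k) / 3"
    and P: "P1 v = \<alpha> * i + \<beta> * j + \<gamma> * k" "P2 v = \<alpha> * l + \<beta> * m - \<gamma> * k"
    and F: "F1 v = - (\<gamma> * y * (y - 1) * i * j * k)" "F2 v = \<gamma> * x * (x - 1) * l * m * k"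
    unfolding A_def B_def P1_def P2_def F1_def F2_def v_def coeff_P1_def coeff_P2_def coeff_F1_def coeff_F2_def prod.case d
    by (simp_all add: algebra_simps add_divide_distrib diff_divide_distrib)
  have pA: "pd1 A v = (\<alpha> * i\<^sup>2 + \<beta> * j\<^sup>2 - 2 * \<gamma> * k\<^sup>2) / 3" "pd1 B v = 2 * \<gamma> * k\<^sup>2 / 3"
    "pd2 B v = (\<alpha> * l\<^sup>2 + \<beta> * m\<^sup>2 - 2 * \<gamma> * k\<^sup>2) / 3"
    and pP: "pd1 P1 v = - (\<alpha> * i\<^sup>2 + \<beta> * j\<^sup>2 + \<gamma> * k\<^sup>2)" "pd2 P1 v = \<gamma> * k\<^sup>2" "pd1 P2 v = \<gamma> * k\<^sup>2"
    "pd2 P2 v = - (\<alpha> * l\<^sup>2 + \<beta> * m\<^sup>2 + \<gamma> * k\<^sup>2)"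
    and pF: "pd2 F1 v = - \<gamma> * ((2 * y - 1) * k + y * (y - 1) * k\<^sup>2) * i * j"
    "pd1 F2 v = - \<gamma> * ((2 * x - 1) * (- k) + x * (x - 1) * (- k)\<^sup>2) * l * m"
    unfolding A_def B_def P1_def P2_def F1_def F2_def v_def pd d
    by (simp_all add: algebra_simps add_divide_distrib diff_divide_distrib)
  show "\<alpha> / x + \<beta> / (x - 1) + (- \<gamma>) / (x - y) = 1/3 * P1 v - 2 * A v"
    "\<alpha> / y + \<beta> / (y - 1) + (- \<gamma>) / (y - x) = 1/3 * P2 v - 2 * B v"
    "\<gamma> * y * (y - 1) / (x * (x - 1) * (x - y)) = - F1 v"
    "\<gamma> * x * (x - 1) / (y * (y - 1) * (y - x)) = - F2 v"
    "1/3 * P1 v = \<gamma> / (x - y) - A v" "1/3 * P2 v = - B v - \<gamma> / (x - y)"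
    unfolding d A P F by (simp_all add: field_simps)
  show "(1 - \<alpha> - \<beta>) * \<gamma> / (x * (x - 1)) =
      (pd2 F1 v - 1/3 * pd1 P1 v - 2/9 * (P1 v)\<^sup>2 - 2/3 * F1 v * P2 v)
      - (pd1 A v + (A v)\<^sup>2) - (1/3 * P1 v - 2 * A v) * A v + F1 v * B v"
  proof -
    have e: "1/3 * P1 v - 2 * A v = \<alpha> * i + \<beta> * j - \<gamma> * k" unfolding A P by (simp add: field_simps)
    show ?thesis
      unfolding e unfolding d A P F pA pP pF by (rule diag_identity[OF r(1-5)])
  qed
  show "(1 - \<alpha> - \<beta>) * \<gamma> / (y * (y - 1)) =
      (pd1 F2 v - 1/3 * pd2 P2 v - 2/9 * (P2 v)\<^sup>2 - 2/3 * F2 v * P1 v)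
      - (pd2 B v + (B v)\<^sup>2) - (1/3 * P2 v - 2 * B v) * B v + F2 v * A v"
  proof -
    \<comment> \<open>Everything is rewritten in terms of \<open>-k\<close>, the reciprocal of
      \<open>y - x\<close>, to match \<open>diag_identity\<close> with the two variables
      exchanged.\<close>
    have e: "1/3 * P2 v - 2 * B v = \<alpha> * l + \<beta> * m - \<gamma> * (- k)" unfolding A P by (simp add: field_simps)
    have A': "B v = (- \<alpha> * l - \<beta> * m + 2 * \<gamma> * (- k)) / 3" "A v = (- \<alpha> * i - \<beta> * j - 2 * \<gamma> * (- k)) / 3"
      and P': "P2 v = \<alpha> * l + \<beta> * m + \<gamma> * (- k)" "P1 v = \<alpha> * i + \<beta> * j - \<gamma> * (- k)"
      and F': "F2 v = - (\<gamma> * x * (x - 1) * l * m * (- k))"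
      and pA': "pd2 B v = (\<alpha> * l\<^sup>2 + \<beta> * m\<^sup>2 - 2 * \<gamma> * (- k)\<^sup>2) / 3"
      and pP': "pd2 P2 v = - (\<alpha> * l\<^sup>2 + \<beta> * m\<^sup>2 + \<gamma> * (- k)\<^sup>2)"
      by (simp_all add: A P F pA pP)
    show ?thesis
      unfolding e unfolding d A' P' F' pA' pP' pF by (rule diag_identity[OF r(4,5,6,1,2)])
  qed
  show "1/3 * pd1 P2 v + 1/3 * pd2 P1 v + 1/9 * P1 v * P2 v - F1 v * F2 v =
      pd1 B v + A v * B v + \<gamma> / (x - y) * A v - \<gamma> / (x - y) * B v"
    unfolding d A P F pA pP pF by (rule mixed_identity[OF r(1-5)])
qed

text \<open>Each operator of the \<open>w\<close>-system applied to \<open>u z\<close> is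
  \<open>u\<close> times the corresponding operator of the \<open>z\<close>-system applied to
  \<open>z\<close>.\<close>

lemma solves_w_systemI_gauge:
  assumes "open D" "nonsingular D" and z: "solves_z_system \<alpha> \<beta> \<gamma> D z"
    and u: "has_log_partials u (coeff_P1 (- \<alpha> / 3) (- \<beta> / 3) (2 * \<gamma> / 3)) (coeff_P2 (- \<alpha> / 3) (- \<beta> / 3) (2 * \<gamma> / 3)) D"
  shows "solves_w_system \<alpha> \<beta> \<gamma> D (\<lambda>v. u v * z v)"
proof -
  let ?w = "\<lambda>v. u v * z v"
  let ?A = "coeff_P1 (- \<alpha> / 3) (- \<beta> / 3) (2 * \<gamma> / 3)" and ?B = "coeff_P2 (- \<alpha> / 3) (- \<beta> / 3) (2 * \<gamma> / 3)"
  let ?P1 = "coeff_P1 \<alpha> \<beta> \<gamma>" and ?P2 = "coeff_P2 \<alpha> \<beta> \<gamma>" and ?F1 = "coeff_F1 \<gamma>" and ?F2 = "coeff_F2 \<gamma>"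
  have ne: "v1 \<noteq> 0 \<and> v1 \<noteq> 1 \<and> v2 \<noteq> 0 \<and> v2 \<noteq> 1 \<and> v1 \<noteq> v2" if "(v1, v2) \<in> D" for v1 v2
    using assms(2) that by (auto simp: nonsingular_def)
  have zh: "z holomorphic2_on D" using z by (simp add: solves_z_system_def)
  note w = gauge_transform[OF u coeff_P_holomorphic2[OF assms(2,1)] zh \<open>open D\<close>]
  show ?thesis unfolding solves_w_system_def
  proof (rule conjI[OF w(1)], clarify, intro conjI)
    fix x y assume v: "(x, y) \<in> D"
    let ?v = "(x, y)"
    have ne': "x \<noteq> 0" "x \<noteq> 1" "y \<noteq> 0" "y \<noteq> 1" "x \<noteq> y" using ne[OF v] by auto
    note c = system_coefficients(1,2)[OF ne', where \<alpha> = \<alpha> and \<beta> = \<beta> and \<gamma> = \<gamma>]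
      system_coefficients(3,4)[OF ne', where \<gamma> = \<gamma>]
      system_coefficients(5-9)[OF ne', where \<alpha> = \<alpha> and \<beta> = \<beta> and \<gamma> = \<gamma>]
    define g where "g = \<gamma> / (x - y)"
    have g: "(- \<gamma>) / (x - y) = - g" "\<gamma> / (x - y) = g" by (simp_all add: g_def)
    have Z: "pd1 (pd1 z) ?v + 1/3 * ?P1 ?v * pd1 z ?v - ?F1 ?v * pd2 z ?v
         + (pd2 ?F1 ?v - 1/3 * pd1 ?P1 ?v - 2/9 * (?P1 ?v)\<^sup>2 - 2/3 * ?F1 ?v * ?P2 ?v) * z ?v = 0"
      "pd1 (pd2 z) ?v - 1/3 * ?P2 ?v * pd1 z ?v - 1/3 * ?P1 ?v * pd2 z ?v
         + (1/3 * pd1 ?P2 ?v + 1/3 * pd2 ?P1 ?v + 1/9 * ?P1 ?v * ?P2 ?v - ?F1 ?v * ?F2 ?v) * z ?v = 0"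
      "pd2 (pd2 z) ?v + 1/3 * ?P2 ?v * pd2 z ?v - ?F2 ?v * pd1 z ?v
         + (pd1 ?F2 ?v - 1/3 * pd2 ?P2 ?v - 2/9 * (?P2 ?v)\<^sup>2 - 2/3 * ?F2 ?v * ?P1 ?v) * z ?v = 0"
      using z v unfolding solves_z_system_def Let_def by blast+
    \<comment> \<open>The zero-order coefficients become opaque, so that the remaining algebra never
      expands their rational expressions.\<close>
    define Q1 where "Q1 = pd2 ?F1 ?v - 1/3 * pd1 ?P1 ?v - 2/9 * (?P1 ?v)\<^sup>2 - 2/3 * ?F1 ?v * ?P2 ?v"
    define Q2 where "Q2 = pd1 ?F2 ?v - 1/3 * pd2 ?P2 ?v - 2/9 * (?P2 ?v)\<^sup>2 - 2/3 * ?F2 ?v * ?P1 ?v"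
    define R where "R = 1/3 * pd1 ?P2 ?v + 1/3 * pd2 ?P1 ?v + 1/9 * ?P1 ?v * ?P2 ?v - ?F1 ?v * ?F2 ?v"
    note Z = Z[folded Q1_def Q2_def R_def] and c = c[folded Q1_def Q2_def R_def g_def]
    have "pd1 (pd1 ?w) ?v + (\<alpha> / x + \<beta> / (x - 1) + (- \<gamma>) / (x - y)) * pd1 ?w ?v
         + (\<gamma> * y * (y - 1)) / (x * (x - 1) * (x - y)) * pd2 ?w ?v
         + ((1 - \<alpha> - \<beta>) * \<gamma>) / (x * (x - 1)) * ?w ?v
       = u ?v * (pd1 (pd1 z) ?v + 1/3 * ?P1 ?v * pd1 z ?v - ?F1 ?v * pd2 z ?v + Q1 * z ?v)"
      unfolding w(2-6)[OF v] c(1,3,7) by (simp add: algebra_simps power2_eq_square)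
    then show "pd1 (pd1 ?w) ?v + (\<alpha> / x + \<beta> / (x - 1) + (- \<gamma>) / (x - y)) * pd1 ?w ?v
         + (\<gamma> * y * (y - 1)) / (x * (x - 1) * (x - y)) * pd2 ?w ?v
         + ((1 - \<alpha> - \<beta>) * \<gamma>) / (x * (x - 1)) * ?w ?v = 0"
      unfolding Z by simp
    have "pd2 (pd2 ?w) ?v + (\<alpha> / y + \<beta> / (y - 1) + (- \<gamma>) / (y - x)) * pd2 ?w ?v
         + (\<gamma> * x * (x - 1)) / (y * (y - 1) * (y - x)) * pd1 ?w ?v
         + ((1 - \<alpha> - \<beta>) * \<gamma>) / (y * (y - 1)) * ?w ?v
       = u ?v * (pd2 (pd2 z) ?v + 1/3 * ?P2 ?v * pd2 z ?v - ?F2 ?v * pd1 z ?v + Q2 * z ?v)"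
      unfolding w(2-6)[OF v] c(2,4,8) by (simp add: algebra_simps power2_eq_square)
    then show "pd2 (pd2 ?w) ?v + (\<alpha> / y + \<beta> / (y - 1) + (- \<gamma>) / (y - x)) * pd2 ?w ?v
         + (\<gamma> * x * (x - 1)) / (y * (y - 1) * (y - x)) * pd1 ?w ?v
         + ((1 - \<alpha> - \<beta>) * \<gamma>) / (y * (y - 1)) * ?w ?v = 0"
      unfolding Z by simp
    have P: "1/3 * ?P1 ?v = g - ?A ?v" "1/3 * ?P2 ?v = - ?B ?v - g"
      by (fact c(5), fact c(6))
    have "pd1 (pd2 ?w) ?v - (- g * pd1 ?w ?v + g * pd2 ?w ?v)
       = u ?v * (pd1 (pd2 z) ?v - 1/3 * ?P2 ?v * pd1 z ?v - 1/3 * ?P1 ?v * pd2 z ?v + R * z ?v)"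
      unfolding w(2-6)[OF v] c(9) P by (simp add: algebra_simps power2_eq_square)
    then show "pd1 (pd2 ?w) ?v = (- \<gamma>) / (x - y) * pd1 ?w ?v + \<gamma> / (x - y) * pd2 ?w ?v"
      unfolding Z g by simp
  qed
qed

text \<open>The converse direction takes its own factor \<open>u\<close> with negated exponents,
  since the branches chosen for the inverse powers need not be reciprocals of those chosen
  before.\<close>

lemma solves_z_systemI_gauge:
  assumes "open D" "nonsingular D" and w: "solves_w_system \<alpha> \<beta> \<gamma> D w"
    and u: "has_log_partials u (coeff_P1 (\<alpha> / 3) (\<beta> / 3) (- 2 * \<gamma> / 3)) (coeff_P2 (\<alpha> / 3) (\<beta> / 3) (- 2 * \<gamma> / 3)) D"
  shows "solves_z_system \<alpha> \<beta> \<gamma> D (\<lambda>v. u v * w v)"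
proof -
  let ?z = "\<lambda>v. u v * w v"
  let ?A = "coeff_P1 (- \<alpha> / 3) (- \<beta> / 3) (2 * \<gamma> / 3)" and ?B = "coeff_P2 (- \<alpha> / 3) (- \<beta> / 3) (2 * \<gamma> / 3)"
  let ?A' = "coeff_P1 (\<alpha> / 3) (\<beta> / 3) (- 2 * \<gamma> / 3)" and ?B' = "coeff_P2 (\<alpha> / 3) (\<beta> / 3) (- 2 * \<gamma> / 3)"
  let ?P1 = "coeff_P1 \<alpha> \<beta> \<gamma>" and ?P2 = "coeff_P2 \<alpha> \<beta> \<gamma>" and ?F1 = "coeff_F1 \<gamma>" and ?F2 = "coeff_F2 \<gamma>"
  have ne: "v1 \<noteq> 0 \<and> v1 \<noteq> 1 \<and> v2 \<noteq> 0 \<and> v2 \<noteq> 1 \<and> v1 \<noteq> v2" if "(v1, v2) \<in> D" for v1 v2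
    using assms(2) that by (auto simp: nonsingular_def)
  have wh: "w holomorphic2_on D" using w by (simp add: solves_w_system_def)
  note z = gauge_transform[OF u coeff_P_holomorphic2[OF assms(2,1)] wh \<open>open D\<close>]
  show ?thesis unfolding solves_z_system_def Let_def
  proof (rule conjI[OF z(1)], rule ballI)
    fix v assume "v \<in> D"
    then obtain x y where v: "(x, y) \<in> D" and v_def: "v = (x, y)" by (cases v) auto
    have ne': "x \<noteq> 0" "x \<noteq> 1" "y \<noteq> 0" "y \<noteq> 1" "x \<noteq> y" using ne[OF v] by auto
    note c = system_coefficients(1,2)[OF ne', where \<alpha> = \<alpha> and \<beta> = \<beta> and \<gamma> = \<gamma>, folded v_def]
      system_coefficients(3,4)[OF ne', where \<gamma> = \<gamma>, folded v_def]
      system_coefficients(5-9)[OF ne', where \<alpha> = \<alpha> and \<beta> = \<beta> and \<gamma> = \<gamma>, folded v_def]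
    define g where "g = \<gamma> / (x - y)"
    have g: "(- \<gamma>) / (x - y) = - g" "\<gamma> / (x - y) = g" by (simp_all add: g_def)
    \<comment> \<open>Negating the exponents negates the logarithmic derivatives, so the same
      coefficient identities serve in this direction.\<close>
    have A': "?A' v = - ?A v" "?B' v = - ?B v" "pd1 ?A' v = - pd1 ?A v" "pd1 ?B' v = - pd1 ?B v"
      "pd2 ?B' v = - pd2 ?B v"
      unfolding v_def pd1_coeff_P1[OF ne'] pd1_coeff_P2[OF ne'] pd2_coeff_P2[OF ne']
      by (simp_all add: coeff_P1_def coeff_P2_def)
    define Q1 where "Q1 = pd2 ?F1 v - 1/3 * pd1 ?P1 v - 2/9 * (?P1 v)\<^sup>2 - 2/3 * ?F1 v * ?P2 v"
    define Q2 where "Q2 = pd1 ?F2 v - 1/3 * pd2 ?P2 v - 2/9 * (?P2 v)\<^sup>2 - 2/3 * ?F2 v * ?P1 v"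
    define R where "R = 1/3 * pd1 ?P2 v + 1/3 * pd2 ?P1 v + 1/9 * ?P1 v * ?P2 v - ?F1 v * ?F2 v"
    note c = c[folded Q1_def Q2_def R_def g_def] and z = z(2-6)[OF \<open>v \<in> D\<close>, unfolded A']
    have "pd1 (pd1 w) v
         + (\<alpha> / x + \<beta> / (x - 1) + (- \<gamma>) / (x - y)) * pd1 w v
         + (\<gamma> * y * (y - 1)) / (x * (x - 1) * (x - y)) * pd2 w v
         + ((1 - \<alpha> - \<beta>) * \<gamma>) / (x * (x - 1)) * w v = 0 \<and>
       pd2 (pd2 w) v
         + (\<alpha> / y + \<beta> / (y - 1) + (- \<gamma>) / (y - x)) * pd2 w v
         + (\<gamma> * x * (x - 1)) / (y * (y - 1) * (y - x)) * pd1 w v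
         + ((1 - \<alpha> - \<beta>) * \<gamma>) / (y * (y - 1)) * w v = 0 \<and>
       pd1 (pd2 w) v
         = (- \<gamma>) / (x - y) * pd1 w v + \<gamma> / (x - y) * pd2 w v"
      using w v unfolding solves_w_system_def v_def by blast
    note W = this
    note W1 = W[THEN conjunct1, unfolded c(1,3,7)] and W2 = W[THEN conjunct2, THEN conjunct1, unfolded c(2,4,8)]
      and W3 = W[THEN conjunct2, THEN conjunct2, unfolded g]
    have "pd1 (pd1 ?z) v + 1/3 * ?P1 v * pd1 ?z v - ?F1 v * pd2 ?z v + Q1 * ?z v =
        u v * (pd1 (pd1 w) v + (1/3 * ?P1 v - 2 * ?A v) * pd1 w v + - ?F1 v * pd2 w v
         + (Q1 - (pd1 ?A v + (?A v)\<^sup>2) - (1/3 * ?P1 v - 2 * ?A v) * ?A v + ?F1 v * ?B v) * w v)"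
      unfolding z by (simp add: algebra_simps power2_eq_square)
    also have "\<dots> = 0" unfolding W1 by simp
    finally have 1: "pd1 (pd1 ?z) v + 1/3 * ?P1 v * pd1 ?z v - ?F1 v * pd2 ?z v + Q1 * ?z v = 0" .
    have "pd2 (pd2 ?z) v + 1/3 * ?P2 v * pd2 ?z v - ?F2 v * pd1 ?z v + Q2 * ?z v =
        u v * (pd2 (pd2 w) v + (1/3 * ?P2 v - 2 * ?B v) * pd2 w v + - ?F2 v * pd1 w v
         + (Q2 - (pd2 ?B v + (?B v)\<^sup>2) - (1/3 * ?P2 v - 2 * ?B v) * ?B v + ?F2 v * ?A v) * w v)"
      unfolding z by (simp add: algebra_simps power2_eq_square)
    also have "\<dots> = 0" unfolding W2 by simp
    finally have 2: "pd2 (pd2 ?z) v + 1/3 * ?P2 v * pd2 ?z v - ?F2 v * pd1 ?z v + Q2 * ?z v = 0" .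
    have P: "1/3 * ?P1 v = g - ?A v" "1/3 * ?P2 v = - ?B v - g"
      by (fact c(5), fact c(6))
    have "pd1 (pd2 ?z) v - 1/3 * ?P2 v * pd1 ?z v - 1/3 * ?P1 v * pd2 ?z v + R * ?z v =
        u v * (pd1 (pd2 w) v - (- g * pd1 w v + g * pd2 w v))"
      unfolding z c(9) P by (simp add: algebra_simps power2_eq_square)
    also have "\<dots> = 0" unfolding W3 by simp
    finally have "pd1 (pd2 ?z) v - 1/3 * ?P2 v * pd1 ?z v - 1/3 * ?P1 v * pd2 ?z v + R * ?z v = 0" .
    with 1 2 show "pd1 (pd1 ?z) v + 1/3 * ?P1 v * pd1 ?z v - ?F1 v * pd2 ?z v
         + (pd2 ?F1 v - 1/3 * pd1 ?P1 v - 2/9 * (?P1 v)\<^sup>2 - 2/3 * ?F1 v * ?P2 v) * ?z v = 0 \<and>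
       pd1 (pd2 ?z) v - 1/3 * ?P2 v * pd1 ?z v - 1/3 * ?P1 v * pd2 ?z v
         + (1/3 * pd1 ?P2 v + 1/3 * pd2 ?P1 v + 1/9 * ?P1 v * ?P2 v - ?F1 v * ?F2 v) * ?z v = 0 \<and>
       pd2 (pd2 ?z) v + 1/3 * ?P2 v * pd2 ?z v - ?F2 v * pd1 ?z v
         + (pd1 ?F2 v - 1/3 * pd2 ?P2 v - 2/9 * (?P2 v)\<^sup>2 - 2/3 * ?F2 v * ?P1 v) * ?z v = 0"
      unfolding Q1_def Q2_def R_def by (intro conjI)
  qed
qed

section \<open>Double power series\<close>

text \<open>A growth condition that gives convergence in the whole unit bidisc and survives termwise
  differentiation, because any factor \<open>m + 1\<close> can be absorbed by a slightly larger base
  \<open>r\<close>.\<close>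

definition subexponential :: "(nat \<Rightarrow> nat \<Rightarrow> complex) \<Rightarrow> bool" where
  "subexponential c \<longleftrightarrow> (\<forall>r>1. \<exists>M. \<forall>m n. norm (c m n) \<le> M * r ^ (m + n))"

definition double_series :: "(nat \<Rightarrow> nat \<Rightarrow> complex) \<Rightarrow> complex \<times> complex \<Rightarrow> complex" where
  "double_series c v = (\<Sum>\<^sub>\<infinity>(m, n)\<in>UNIV. c m n * fst v ^ m * snd v ^ n)"

text \<open>The coefficients of the termwise partial derivative in the first variable.\<close>

definition cshift1 :: "(nat \<Rightarrow> nat \<Rightarrow> complex) \<Rightarrow> nat \<Rightarrow> nat \<Rightarrow> complex" where
  "cshift1 c m n = of_nat (Suc m) * c (Suc m) n"

definition cshift2 :: "(nat \<Rightarrow> nat \<Rightarrow> complex) \<Rightarrow> nat \<Rightarrow> nat \<Rightarrow> complex" where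
  "cshift2 c m n = of_nat (Suc n) * c m (Suc n)"

lemma summable_on_geometric_product:
  fixes a b :: real
  assumes "0 \<le> a" "a < 1" "0 \<le> b" "b < 1"
  shows "(\<lambda>(m, n). K * a ^ m * b ^ n) summable_on (UNIV :: (nat \<times> nat) set)"
proof -
  have geo: "((^) c has_sum (1 / (1 - c))) UNIV" if "0 \<le> c" "c < 1" for c :: real
  proof -
    have "summable (\<lambda>n. norm (c ^ n))" using that by simp
    moreover have "(^) c sums (1 / (1 - c))" using that by (simp add: geometric_sums)
    ultimately show ?thesis by (rule norm_summable_imp_has_sum)
  qed
  have "(\<lambda>(m, n). a ^ m * b ^ n) summable_on (UNIV \<times> UNIV :: (nat \<times> nat) set)"
  proof (rule summable_on_SigmaI[where g = "\<lambda>m. a ^ m * (1 / (1 - b))"])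
    show "((\<lambda>n. (case (m, n) of (m, n) \<Rightarrow> a ^ m * b ^ n)) has_sum a ^ m * (1 / (1 - b))) UNIV" for m
      using has_sum_cmult_right[OF geo[OF assms(3,4)]] by simp
    show "(\<lambda>m. a ^ m * (1 / (1 - b))) summable_on UNIV"
      by (rule summable_on_cmult_left[OF has_sum_imp_summable[OF geo[OF assms(1,2)]]])
  qed (use assms in auto)
  from summable_on_cmult_right[OF this, of K] show ?thesis
    by (simp add: case_prod_unfold mult.assoc)
qed

text \<open>A summable majorant that is uniform on a closed bidisc, as required by the Weierstrass
  test.\<close>

lemma subexponential_dominated:
  assumes "subexponential c" "\<rho> < 1"
  shows "\<exists>M. M summable_on UNIV \<and> (\<forall>p. \<forall>v\<in>cball 0 \<rho> \<times> cball 0 \<rho>.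
       norm (case p of (m, n) \<Rightarrow> c m n * fst v ^ m * snd v ^ n) \<le> M p)"
proof -
  \<comment> \<open>The maximum keeps \<open>s\<close> positive even if \<rho> is not. The base
    \<open>r\<close> chosen next is the midpoint of 1 and \<open>1 / s\<close>, hence
    \<open>r > 1\<close> and \<open>r * s = (1 + s) / 2 < 1\<close>.\<close>
  define s where "s = max \<rho> (1/2)"
  have s: "0 < s" "s < 1" "\<rho> \<le> s" using assms(2) by (auto simp: s_def)
  define r where "r = (1 + 1 / s) / 2"
  have r: "1 < r" "r * s < 1" using s by (auto simp: r_def field_simps)
  obtain K where K: "\<And>m n. norm (c m n) \<le> K * r ^ (m + n)"
    using assms(1) r(1) unfolding subexponential_def by blast
  have "norm (c m n * x ^ m * y ^ n) \<le> K * (r * s) ^ m * (r * s) ^ n"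
    if "norm x \<le> \<rho>" "norm y \<le> \<rho>" for x y m n
  proof -
    have "norm (c m n * x ^ m * y ^ n) = norm (c m n) * (norm x ^ m * norm y ^ n)"
      by (simp add: norm_mult norm_power)
    also have "\<dots> \<le> (K * r ^ (m + n)) * (s ^ m * s ^ n)"
      using that s K[of m n] order_trans[OF norm_ge_zero K]
      by (intro mult_mono power_mono) auto
    finally show ?thesis by (simp add: power_add power_mult_distrib algebra_simps)
  qed
  then have "norm (case p of (m, n) \<Rightarrow> c m n * fst v ^ m * snd v ^ n) \<le>
      (case p of (m, n) \<Rightarrow> K * (r * s) ^ m * (r * s) ^ n)"
    if "v \<in> cball 0 \<rho> \<times> cball 0 \<rho>" for p v
    using that by (auto split: prod.split)
  moreover have "(\<lambda>(m, n). K * (r * s) ^ m * (r * s) ^ n) summable_on (UNIV :: (nat \<times> nat) set)"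
    by (rule summable_on_geometric_product) (use r s in auto)
  ultimately show ?thesis
    by (intro exI[of _ "\<lambda>(m, n). K * (r * s) ^ m * (r * s) ^ n"] conjI allI ballI)
qed

lemma double_series_has_sum:
  assumes "subexponential c" "x \<in> ball 0 1" "y \<in> ball 0 1"
  shows "((\<lambda>(m, n). c m n * x ^ m * y ^ n) has_sum double_series c (x, y)) UNIV"
proof -
  define \<rho> where "\<rho> = max (norm x) (norm y)"
  have "\<rho> < 1" using assms by (simp add: \<rho>_def)
  obtain M where M: "M summable_on UNIV" "\<And>p v. v \<in> cball 0 \<rho> \<times> cball 0 \<rho> \<Longrightarrow>
       norm (case p of (m, n) \<Rightarrow> c m n * fst v ^ m * snd v ^ n) \<le> M p"
    using subexponential_dominated[OF assms(1) \<open>\<rho> < 1\<close>] by blast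
  have "(x, y) \<in> cball 0 \<rho> \<times> cball 0 \<rho>" by (simp add: \<rho>_def)
  from M(2)[OF this] have "(\<lambda>p. norm (case p of (m, n) \<Rightarrow> c m n * x ^ m * y ^ n)) summable_on UNIV"
    by (intro summable_on_comparison_test[OF M(1)]) simp_all
  then show ?thesis
    unfolding double_series_def by (simp add: abs_summable_summable)
qed

lemma double_series_uniform_limit:
  assumes "subexponential c" "\<rho> < 1"
  shows "uniform_limit (cball 0 \<rho> \<times> cball 0 \<rho>) (\<lambda>X v. \<Sum>(m, n)\<in>X. c m n * fst v ^ m * snd v ^ n)
     (double_series c) (finite_subsets_at_top UNIV)"
proof -
  obtain M where M: "M summable_on UNIV" "\<And>p v. v \<in> cball 0 \<rho> \<times> cball 0 \<rho> \<Longrightarrow>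
       norm (case p of (m, n) \<Rightarrow> c m n * fst v ^ m * snd v ^ n) \<le> M p"
    using subexponential_dominated[OF assms] by blast
  have "uniform_limit (cball 0 \<rho> \<times> cball 0 \<rho>)
     (\<lambda>X v. \<Sum>p\<in>X. case p of (m, n) \<Rightarrow> c m n * fst v ^ m * snd v ^ n)
     (\<lambda>v. \<Sum>\<^sub>\<infinity>p\<in>UNIV. case p of (m, n) \<Rightarrow> c m n * fst v ^ m * snd v ^ n) (finite_subsets_at_top UNIV)"
    by (rule Weierstrass_m_test_general[OF M(2) M(1)])
  then show ?thesis unfolding double_series_def .
qed

lemma continuous_on_double_series:
  assumes "subexponential c"
  shows "continuous_on (ball 0 1 \<times> ball 0 1) (double_series c)"
proof (rule continuous_at_imp_continuous_on, clarify)
  fix x y :: complex assume xy: "x \<in> ball 0 1" "y \<in> ball 0 1"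
  obtain \<rho> where \<rho>: "max (norm x) (norm y) < \<rho>" "\<rho> < 1"
    using dense[of "max (norm x) (norm y)" 1] xy by auto
  have "continuous_on (cball 0 \<rho> \<times> cball 0 \<rho>) (double_series c)"
    by (rule uniform_limit_theorem[OF _ double_series_uniform_limit[OF assms \<rho>(2)]])
       (auto intro!: always_eventually continuous_intros simp: case_prod_unfold)
  then have "continuous_on (ball 0 \<rho> \<times> ball 0 \<rho>) (double_series c)"
    by (rule continuous_on_subset) auto
  moreover have "(x, y) \<in> ball 0 \<rho> \<times> ball 0 \<rho>" using \<rho> by simp
  ultimately show "isCont (double_series c) (x, y)"
    by (simp add: continuous_on_eq_continuous_at open_Times)
qed

lemma linear_le_exponential:
  fixes r :: real
  assumes "r > 1"
  shows "\<exists>K. \<forall>m. real (Suc m) \<le> K * r ^ m"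
proof -
  \<comment> \<open>Chosen so that \<open>\<delta> * (m + 1)\<close> is at most
    \<open>1 + m * (r - 1)\<close>, the lower bound for \<open>r ^ m\<close> in Bernoulli's
    inequality.\<close>
  define \<delta> where "\<delta> = min 1 (r - 1)"
  have \<delta>: "\<delta> > 0" "\<delta> \<le> 1" "\<delta> \<le> r - 1" using assms by (auto simp: \<delta>_def)
  have "real (Suc m) \<le> (1 / \<delta>) * r ^ m" for m
  proof -
    have "\<delta> * real (Suc m) \<le> 1 + real m * (r - 1)"
      using \<delta> mult_left_mono[OF \<delta>(3), of "real m"] by (simp add: algebra_simps)
    also have "\<dots> \<le> r ^ m" using Bernoulli_inequality[of "r - 1" m] assms by simp
    finally show ?thesis using \<delta> by (simp add: field_simps)
  qed
  then show ?thesis by blast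
qed

lemma subexponential_transpose: "subexponential c \<Longrightarrow> subexponential (\<lambda>m n. c n m)"
  unfolding subexponential_def by (subst add.commute) blast

lemma subexponential_cshift1:
  assumes "subexponential c"
  shows "subexponential (cshift1 c)"
  unfolding subexponential_def
proof (intro allI impI)
  fix r :: real assume "r > 1"
  \<comment> \<open>One factor \<open>s\<close> per index bounds the coefficients of
    \<open>c\<close>, the other absorbs the linear factor \<open>m + 1\<close>.\<close>
  define s where "s = sqrt r"
  have s: "s > 1" "s * s = r" using \<open>r > 1\<close> by (auto simp: s_def)
  obtain M where M: "\<And>m n. norm (c m n) \<le> M * s ^ (m + n)"
    using assms s unfolding subexponential_def by blast
  obtain K where K: "\<And>m. real (Suc m) \<le> K * s ^ m" using linear_le_exponential[OF s(1)] by blast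
  have M0: "M \<ge> 0" using order_trans[OF norm_ge_zero M[of 0 0]] by simp
  have K0: "K \<ge> 0" using K[of 0] by simp
  have "norm (cshift1 c m n) \<le> (K * M * s) * r ^ (m + n)" for m n
  proof -
    have "norm (cshift1 c m n) = real (Suc m) * norm (c (Suc m) n)"
      by (simp only: cshift1_def norm_mult norm_of_nat)
    also have "\<dots> \<le> (K * s ^ m) * (M * s ^ (Suc m + n))"
      by (rule mult_mono[OF K M]) (use s K0 in simp_all)
    also have "\<dots> \<le> (K * s ^ (m + n)) * (M * s ^ (Suc m + n))"
      using s K0 M0 by (intro mult_right_mono mult_left_mono power_increasing) simp_all
    also have "\<dots> = (K * M * s) * (s ^ (m + n) * s ^ (m + n))" by simp
    also have "\<dots> = (K * M * s) * r ^ (m + n)" unfolding s(2)[symmetric] power_mult_distrib ..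
    finally show ?thesis .
  qed
  then show "\<exists>M. \<forall>m n. norm (cshift1 c m n) \<le> M * r ^ (m + n)" by blast
qed

lemma cshift2_transpose: "cshift2 c = (\<lambda>m n. cshift1 (\<lambda>m n. c n m) n m)"
  by (simp add: cshift1_def cshift2_def fun_eq_iff)

lemma subexponential_cshift2: "subexponential c \<Longrightarrow> subexponential (cshift2 c)"
  unfolding cshift2_transpose
  by (rule subexponential_transpose, rule subexponential_cshift1, rule subexponential_transpose)

lemma double_series_transpose: "double_series (\<lambda>m n. c n m) (y, x) = double_series c (x, y)"
proof -
  have "double_series c (x, y) = infsum (\<lambda>(m, n). c m n * x ^ m * y ^ n) (prod.swap ` UNIV)"
    by (simp add: double_series_def)
  also have "\<dots> = infsum ((\<lambda>(m, n). c m n * x ^ m * y ^ n) \<circ> prod.swap) UNIV"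
    by (rule infsum_reindex) simp
  also have "(\<lambda>(m, n). c m n * x ^ m * y ^ n) \<circ> prod.swap = (\<lambda>(m, n). c n m * y ^ m * x ^ n)"
    by (auto simp: fun_eq_iff mult_ac)
  finally show ?thesis by (simp add: double_series_def)
qed

text \<open>Used where a factor \<open>m\<close> kills the row \<open>m = 0\<close>, as in a
  differentiated series.\<close>

lemma has_sum_Suc_fst:
  fixes g :: "nat \<times> nat \<Rightarrow> complex"
  assumes "\<And>n. g (0, n) = 0"
  shows "(g has_sum s) UNIV \<longleftrightarrow> ((\<lambda>(m, n). g (Suc m, n)) has_sum s) UNIV"
proof -
  have "(g has_sum s) UNIV \<longleftrightarrow> (g has_sum s) (map_prod Suc id ` UNIV)"
  proof (rule has_sum_cong_neutral)
    fix p :: "nat \<times> nat" assume "p \<in> UNIV - map_prod Suc id ` UNIV"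
    moreover have "(Suc m, n) \<in> map_prod Suc id ` UNIV" for m n :: nat
      by (rule image_eqI[of _ _ "(m, n)"]) auto
    ultimately have "fst p = 0" by (cases p; cases "fst p") auto
    then show "g p = 0" using assms by (cases p) simp
  qed auto
  also have "\<dots> \<longleftrightarrow> ((g \<circ> map_prod Suc id) has_sum s) UNIV"
    by (rule has_sum_reindex) (auto simp: inj_on_def)
  also have "g \<circ> map_prod Suc id = (\<lambda>(m, n). g (Suc m, n))" by (auto simp: fun_eq_iff)
  finally show ?thesis .
qed

text \<open>The finite partial sums converge uniformly on a disc around 0 that contains
  \<open>x\<close>, so their derivatives converge to the derivative of the limit. Dropping the
  vanishing row \<open>m = 0\<close> identifies that limit with the series of
  \<open>cshift1 c\<close>.\<close>

lemma double_series_partial1: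
  assumes c: "subexponential c" and xy: "x \<in> ball 0 1" "y \<in> ball 0 1"
  shows "((\<lambda>t. double_series c (t, y)) has_field_derivative double_series (cshift1 c) (x, y)) (at x)"
proof -
  obtain \<rho> where \<rho>: "max (norm x) (norm y) < \<rho>" "\<rho> < 1"
    using dense[of "max (norm x) (norm y)" 1] xy by auto
  then have "\<rho> > 0" using norm_ge_zero[of x] by linarith
  let ?F = "finite_subsets_at_top (UNIV :: (nat \<times> nat) set)"
  have "\<forall>\<^sub>F X in ?F. continuous_on (cball 0 \<rho>) (\<lambda>t. \<Sum>(m, n)\<in>X. c m n * t ^ m * y ^ n) \<and>
      (\<forall>w\<in>ball 0 \<rho>. ((\<lambda>t. \<Sum>(m, n)\<in>X. c m n * t ^ m * y ^ n) has_field_derivative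
         (\<Sum>(m, n)\<in>X. of_nat m * w ^ (m - 1) * c m n * y ^ n)) (at w))"
    by (intro always_eventually allI conjI ballI)
       (auto simp: case_prod_unfold intro!: continuous_intros derivative_eq_intros)
  moreover have "uniform_limit (cball 0 \<rho>) (\<lambda>X t. \<Sum>(m, n)\<in>X. c m n * t ^ m * y ^ n)
      (\<lambda>t. double_series c (t, y)) ?F"
    using uniform_limit_compose'[OF double_series_uniform_limit[OF c \<rho>(2)], where h = "\<lambda>t. (t, y)" and B = "cball 0 \<rho>"] \<rho>
    by (simp add: Pi_iff)
  ultimately obtain g' where g': "\<And>w. w \<in> ball 0 \<rho> \<Longrightarrow>
      ((\<lambda>t. double_series c (t, y)) has_field_derivative g' w) (at w) \<and>
      ((\<lambda>X. \<Sum>(m, n)\<in>X. of_nat m * w ^ (m - 1) * c m n * y ^ n) \<longlongrightarrow> g' w) ?F"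
    by (rule has_complex_derivative_uniform_limit) (use \<open>\<rho> > 0\<close> in auto)
  have x: "x \<in> ball 0 \<rho>" using \<rho> by simp
  from g'[OF x] have "((\<lambda>(m, n). of_nat m * x ^ (m - 1) * c m n * y ^ n) has_sum g' x) UNIV"
    by (simp add: has_sum_def)
  then have "((\<lambda>(m, n). of_nat (Suc m) * x ^ m * c (Suc m) n * y ^ n) has_sum g' x) UNIV"
    by (subst (asm) has_sum_Suc_fst) (auto simp del: of_nat_Suc)
  also have "(\<lambda>(m, n). of_nat (Suc m) * x ^ m * c (Suc m) n * y ^ n) =
     (\<lambda>(m, n). cshift1 c m n * x ^ m * y ^ n)"
    by (simp add: cshift1_def mult_ac)
  finally have "((\<lambda>(m, n). cshift1 c m n * x ^ m * y ^ n) has_sum g' x) UNIV" .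
  then have "g' x = double_series (cshift1 c) (x, y)"
    using double_series_has_sum[OF subexponential_cshift1[OF c] xy] has_sum_unique by blast
  with g'[OF x] show ?thesis by simp
qed

lemma double_series_partial2:
  assumes c: "subexponential c" and xy: "x \<in> ball 0 1" "y \<in> ball 0 1"
  shows "((\<lambda>t. double_series c (x, t)) has_field_derivative double_series (cshift2 c) (x, y)) (at y)"
proof -
  have "double_series (\<lambda>m n. c n m) (t, x) = double_series c (x, t)" for t
    by (rule double_series_transpose)
  moreover have "double_series (cshift1 (\<lambda>m n. c n m)) (y, x) = double_series (cshift2 c) (x, y)"
    unfolding cshift2_transpose by (rule double_series_transpose[symmetric])
  ultimately show ?thesis
    using double_series_partial1[OF subexponential_transpose[OF c] xy(2,1)] by (simp only:)
qed

lemma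
  assumes c: "subexponential c"
  shows double_series_holomorphic2: "double_series c holomorphic2_on ball 0 1 \<times> ball 0 1"
    and pd1_double_series: "v \<in> ball 0 1 \<times> ball 0 1 \<Longrightarrow> pd1 (double_series c) v = double_series (cshift1 c) v"
    and pd2_double_series: "v \<in> ball 0 1 \<times> ball 0 1 \<Longrightarrow> pd2 (double_series c) v = double_series (cshift2 c) v"
proof -
  show 1: "pd1 (double_series c) v = double_series (cshift1 c) v"
    and 2: "pd2 (double_series c) v = double_series (cshift2 c) v"
    if "v \<in> ball 0 1 \<times> ball 0 1" for v
    using that double_series_partial1[OF c, THEN DERIV_imp_deriv] double_series_partial2[OF c, THEN DERIV_imp_deriv]
    by (auto simp: pd1_def pd2_def)
  have "separately_holomorphic (double_series c) (ball 0 1 \<times> ball 0 1)"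
    unfolding separately_holomorphic_def
    using continuous_on_double_series[OF c] double_series_partial1[OF c] double_series_partial2[OF c]
    by (auto simp: 1 2)
  then show "double_series c holomorphic2_on ball 0 1 \<times> ball 0 1"
    by (rule separately_holomorphic_imp_holomorphic2) (simp add: open_Times)
qed

section \<open>The Appell series\<close>

text \<open>Exchange of the two indices as a named constant, so that its laws can be used as rewrite
  rules.\<close>

definition ctranspose :: "(nat \<Rightarrow> nat \<Rightarrow> complex) \<Rightarrow> nat \<Rightarrow> nat \<Rightarrow> complex" where
  "ctranspose c m n = c n m"

lemma cshift_ctranspose:
  "cshift1 (ctranspose c) = ctranspose (cshift2 c)" "cshift2 (ctranspose c) = ctranspose (cshift1 c)"
  by (simp_all add: fun_eq_iff cshift1_def cshift2_def ctranspose_def)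

lemma double_series_ctranspose: "double_series (ctranspose c) (y, x) = double_series c (x, y)"
  unfolding ctranspose_def by (rule double_series_transpose)

lemma subexponential_ctranspose: "subexponential c \<Longrightarrow> subexponential (ctranspose c)"
  unfolding ctranspose_def by (rule subexponential_transpose)

lemma cshift_commute: "cshift2 (cshift1 c) = cshift1 (cshift2 c)"
  by (simp add: fun_eq_iff cshift1_def cshift2_def)

lemma has_sum_diff:
  fixes f g :: "'a \<Rightarrow> complex"
  assumes "(f has_sum s) A" "(g has_sum t) A"
  shows "((\<lambda>x. f x - g x) has_sum s - t) A"
  using has_sum_add[OF assms(1) has_sum_cmult_right[OF assms(2), of "- 1"]] by simp

text \<open>Multiplication by \<open>x\<close> moves every coefficient up one row, leaving the row
  \<open>m = 0\<close> empty. It serves both for the Euler operator \<open>x d/dx\<close> and for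
  the terms of Appell's equation with an extra factor \<open>x\<close>.\<close>

lemma has_sum_times_fst:
  fixes d e :: "nat \<Rightarrow> nat \<Rightarrow> complex"
  assumes "((\<lambda>(m, n). of_nat (Suc m) * d m n * x ^ m * y ^ n) has_sum s) UNIV"
    and "\<And>m n. of_nat (Suc m) * d m n = e (Suc m) n" "\<And>n. e 0 n = 0"
  shows "((\<lambda>(m, n). e m n * x ^ m * y ^ n) has_sum x * s) (UNIV :: (nat \<times> nat) set)"
proof -
  have "((\<lambda>p. x * (case p of (m, n) \<Rightarrow> of_nat (Suc m) * d m n * x ^ m * y ^ n)) has_sum x * s) UNIV"
    by (rule has_sum_cmult_right) fact
  then show ?thesis
    by (subst has_sum_Suc_fst) (simp_all add: assms(2,3) case_prod_unfold mult_ac del: of_nat_Suc)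
qed

lemma has_sum_euler1:
  assumes "subexponential c" "x \<in> ball 0 1" "y \<in> ball 0 1"
  shows "((\<lambda>(m, n). of_nat m * c m n * x ^ m * y ^ n) has_sum x * double_series (cshift1 c) (x, y)) UNIV"
  by (rule has_sum_times_fst[where d = "\<lambda>m n. c (Suc m) n"])
     (use double_series_has_sum[OF subexponential_cshift1[OF assms(1)] assms(2,3)] in
       \<open>simp_all add: cshift1_def del: of_nat_Suc\<close>)

lemma has_sum_swap_UNIV:
  "(f has_sum s) (UNIV :: ('a \<times> 'b) set) \<longleftrightarrow> ((\<lambda>(m, n). f (n, m)) has_sum s) UNIV"
proof -
  have "(f has_sum s) (range prod.swap) \<longleftrightarrow> ((f \<circ> prod.swap) has_sum s) UNIV"
    by (rule has_sum_reindex) simp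
  moreover have "f \<circ> prod.swap = (\<lambda>(m, n). f (n, m))" by auto
  ultimately show ?thesis by simp
qed

lemma has_sum_euler2:
  assumes "subexponential c" "x \<in> ball 0 1" "y \<in> ball 0 1"
  shows "((\<lambda>(m, n). of_nat n * c m n * x ^ m * y ^ n) has_sum y * double_series (cshift2 c) (x, y)) UNIV"
proof -
  have "((\<lambda>(m, n). of_nat m * ctranspose c m n * y ^ m * x ^ n) has_sum y * double_series (cshift2 c) (x, y)) UNIV"
    using has_sum_euler1[OF subexponential_ctranspose[OF assms(1)] assms(3,2)]
    unfolding cshift_ctranspose double_series_ctranspose .
  then show ?thesis
    by (subst has_sum_swap_UNIV) (simp add: ctranspose_def mult_ac case_prod_unfold)
qed

section \<open>Recurrences and growth of the Appell coefficients\<close>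

definition appell_coeff :: "complex \<Rightarrow> complex \<Rightarrow> complex \<Rightarrow> complex \<Rightarrow> nat \<Rightarrow> nat \<Rightarrow> complex" where
  "appell_coeff a b b' c m n = (pochhammer a (m + n) * pochhammer b m * pochhammer b' n)
          / (pochhammer c (m + n) * fact m * fact n)"

lemma appell_F1_eq_double_series: "appell_F1 a b b' c x y = double_series (appell_coeff a b b' c) (x, y)"
  by (simp add: appell_F1_def double_series_def appell_coeff_def)

lemma ctranspose_appell_coeff: "ctranspose (appell_coeff a b b' c) = appell_coeff a b' b c"
  by (simp add: fun_eq_iff ctranspose_def appell_coeff_def add.commute mult_ac)

lemma add_of_nat_nonzero:
  fixes c :: complex
  assumes "c \<notin> \<int>\<^sub>\<le>\<^sub>0"
  shows "c + of_nat k \<noteq> 0"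
proof
  assume "c + of_nat k = 0"
  then have "c = - of_nat k" by (simp add: add_eq_0_iff2)
  with assms show False by simp
qed

lemma pochhammer_nonzero:
  fixes c :: complex
  assumes "c \<notin> \<int>\<^sub>\<le>\<^sub>0"
  shows "pochhammer c k \<noteq> 0"
proof
  assume "pochhammer c k = 0"
  then obtain j where "c = - of_nat j" by (auto simp: pochhammer_eq_0_iff)
  with assms show False by simp
qed

lemma appell_coeff_Suc:
  assumes "c \<notin> \<int>\<^sub>\<le>\<^sub>0"
  shows "of_nat (Suc m) * (c + of_nat m + of_nat n) * appell_coeff a b b' c (Suc m) n =
    (a + of_nat m + of_nat n) * (b + of_nat m) * appell_coeff a b b' c m n" (is ?A)
    and "of_nat (Suc n) * (c + of_nat m + of_nat n) * appell_coeff a b b' c m (Suc n) =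
    (a + of_nat m + of_nat n) * (b' + of_nat n) * appell_coeff a b b' c m n" (is ?B)
proof -
  have *: "of_nat (Suc m) * (c + of_nat m + of_nat n) * appell_coeff a b b' c (Suc m) n =
    (a + of_nat m + of_nat n) * (b + of_nat m) * appell_coeff a b b' c m n" for m n b b'
  proof -
    have 0: "of_nat (Suc m) \<noteq> (0 :: complex)" "c + of_nat m + of_nat n \<noteq> 0" "pochhammer c (m + n) \<noteq> 0"
      using add_of_nat_nonzero[OF assms, of "m + n"] pochhammer_nonzero[OF assms]
      by (simp_all add: add.assoc del: of_nat_Suc)
    have "fact (Suc m) = of_nat (Suc m) * (fact m :: complex)" by (rule fact_Suc)
    then have "appell_coeff a b b' c (Suc m) n =
       (pochhammer a (m + n) * (a + of_nat m + of_nat n) * (pochhammer b m * (b + of_nat m)) * pochhammer b' n) /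
       (pochhammer c (m + n) * (c + of_nat m + of_nat n) * (of_nat (Suc m) * fact m) * fact n)"
      by (simp add: appell_coeff_def pochhammer_Suc add.assoc del: of_nat_Suc)
    then show ?thesis
      by (simp only:) (use 0 in \<open>simp add: appell_coeff_def divide_simps del: of_nat_Suc\<close>)
  qed
  show ?A by (rule *)
  have "appell_coeff a b b' c m n = appell_coeff a b' b c n m" for m n
    by (simp add: appell_coeff_def add.commute mult_ac)
  then show ?B using *[of n m b' b] by (simp add: add_ac)
qed

text \<open>The ratio test as a growth bound: beyond some index, each step multiplies the norm by
  less than \<open>r\<close>. The ratio is given as a multiplier \<open>q\<close>, so that
  \<open>f\<close> may vanish, as \<open>pochhammer a n\<close> does eventually when
  \<open>a\<close> is a nonpositive integer.\<close>

lemma ratio_exponential_bound: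
  fixes f q :: "nat \<Rightarrow> complex"
  assumes f: "\<And>n. f (Suc n) = f n * q n" and q: "q \<longlonglongrightarrow> 1" and "r > 1"
  shows "\<exists>M. \<forall>n. norm (f n) \<le> M * r ^ n"
proof -
  have "(\<lambda>n. norm (q n)) \<longlonglongrightarrow> 1" using tendsto_norm[OF q] by simp
  then have "\<forall>\<^sub>F n in sequentially. norm (q n) < r" using \<open>r > 1\<close> by (rule order_tendstoD)
  then obtain N where N: "\<And>n. n \<ge> N \<Longrightarrow> norm (q n) < r" by (auto simp: eventually_sequentially)
  define M where "M = (\<Sum>n\<le>N. norm (f n))"
  have "norm (f n) \<le> M * r ^ n" for n
  proof (induction n)
    case 0
    have "norm (f 0) \<le> M" unfolding M_def by (rule member_le_sum) auto
    then show ?case by simp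
  next
    case (Suc n)
    show ?case
    proof (cases "Suc n \<le> N")
      case True
      then have "norm (f (Suc n)) \<le> M" unfolding M_def by (intro member_le_sum) auto
      also have "\<dots> \<le> M * r ^ Suc n"
        using \<open>r > 1\<close> mult_left_mono[OF one_le_power[of r "Suc n"], of M] by (simp add: M_def sum_nonneg)
      finally show ?thesis .
    next
      case False
      have "norm (f (Suc n)) = norm (f n) * norm (q n)" by (simp add: f norm_mult)
      also have "\<dots> \<le> (M * r ^ n) * r"
        using Suc N[of n] False order_trans[OF norm_ge_zero Suc] by (intro mult_mono) auto
      finally show ?thesis by (simp add: mult_ac)
    qed
  qed
  then show ?thesis by blast
qed

lemma tendsto_shifted_ratio:
  fixes a c :: complex
  assumes "c \<notin> \<int>\<^sub>\<le>\<^sub>0"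
  shows "(\<lambda>n. (a + of_nat n) / (c + of_nat n)) \<longlonglongrightarrow> 1"
proof -
  have "filterlim (\<lambda>n. c + of_nat n) at_infinity sequentially"
    by (intro tendsto_add_filterlim_at_infinity[OF tendsto_const] tendsto_of_nat)
  then have "(\<lambda>n. (a - c) / (c + of_nat n)) \<longlonglongrightarrow> 0"
    by (rule tendsto_divide_0[OF tendsto_const])
  then have "(\<lambda>n. 1 + (a - c) / (c + of_nat n)) \<longlonglongrightarrow> 1"
    using tendsto_add[OF tendsto_const] by fastforce
  moreover have "1 + (a - c) / (c + of_nat n) = (a + of_nat n) / (c + of_nat n)" for n
    using add_of_nat_nonzero[OF assms, of n] by (simp add: field_simps)
  ultimately show ?thesis by simp
qed

lemma pochhammer_ratio_bound:
  fixes a c :: complex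
  assumes "c \<notin> \<int>\<^sub>\<le>\<^sub>0" "r > 1"
  shows "\<exists>M. \<forall>n. norm (pochhammer a n / pochhammer c n) \<le> M * r ^ n"
  by (rule ratio_exponential_bound[OF _ tendsto_shifted_ratio[OF assms(1), of a] assms(2)])
     (simp add: pochhammer_Suc)

lemma subexponential_appell_coeff:
  assumes "c \<notin> \<int>\<^sub>\<le>\<^sub>0"
  shows "subexponential (appell_coeff a b b' c)"
  unfolding subexponential_def
proof (intro allI impI)
  fix r :: real assume "r > 1"
  \<comment> \<open>The three Pochhammer quotients contribute the exponents \<open>m + n\<close>,
    \<open>m\<close> and \<open>n\<close>, which add up to \<open>2 (m + n)\<close>.\<close>
  define s where "s = sqrt r"
  have s: "s > 1" "r = s * s" using \<open>r > 1\<close> by (auto simp: s_def)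
  \<comment> \<open>The factorials are the Pochhammer symbols of 1, so the same quotient bound
    applies to them.\<close>
  have 1: "(1 :: complex) \<notin> \<int>\<^sub>\<le>\<^sub>0" by (auto elim!: nonpos_Ints_cases)
  obtain K L L' where K: "\<And>n. norm (pochhammer a n / pochhammer c n) \<le> K * s ^ n"
    and L: "\<And>n. norm (pochhammer b n / fact n) \<le> L * s ^ n"
    and L': "\<And>n. norm (pochhammer b' n / fact n) \<le> L' * s ^ n"
    using pochhammer_ratio_bound[OF assms s(1)] pochhammer_ratio_bound[OF 1 s(1)] unfolding pochhammer_fact[symmetric]
    by blast
  have nonneg: "K \<ge> 0" "L \<ge> 0" "L' \<ge> 0"
    using order_trans[OF norm_ge_zero K[of 0]] order_trans[OF norm_ge_zero L[of 0]]
      order_trans[OF norm_ge_zero L'[of 0]] by simp_all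
  have "norm (appell_coeff a b b' c m n) \<le> (K * L * L') * r ^ (m + n)" for m n
  proof -
    have "appell_coeff a b b' c m n =
        (pochhammer a (m + n) / pochhammer c (m + n)) * (pochhammer b m / fact m) * (pochhammer b' n / fact n)"
      by (simp add: appell_coeff_def)
    then have "norm (appell_coeff a b b' c m n) =
        norm (pochhammer a (m + n) / pochhammer c (m + n)) * norm (pochhammer b m / fact m) * norm (pochhammer b' n / fact n)"
      by (simp only: norm_mult)
    also have "\<dots> \<le> (K * s ^ (m + n)) * (L * s ^ m) * (L' * s ^ n)"
      by (intro mult_mono K L L' mult_nonneg_nonneg norm_ge_zero) (use nonneg s in simp_all)
    also have "\<dots> = (K * L * L') * (s ^ (m + n) * s ^ (m + n))" by (simp add: power_add)
    also have "\<dots> = (K * L * L') * r ^ (m + n)" unfolding s(2) power_mult_distrib ..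
    finally show ?thesis .
  qed
  then show "\<exists>M. \<forall>m n. norm (appell_coeff a b b' c m n) \<le> M * r ^ (m + n)" by blast
qed

text \<open>The coefficient of \<open>x ^ m * y ^ n\<close> on the left is
  \<open>(m + 1) (c + m + n) C (m + 1) n - (a + m + n) (b + m) C m n\<close>, which is zero by the
  recurrence. Each term of the equation is summed separately, with Euler operators acting as
  multiplication by \<open>m\<close> or \<open>n\<close>.\<close>

lemma appell_series_equation1:
  fixes a b b' c x y :: complex
  assumes c: "c \<notin> \<int>\<^sub>\<le>\<^sub>0" and xy: "x \<in> ball 0 1" "y \<in> ball 0 1"
  defines "S \<equiv> \<lambda>d. double_series d (x, y)" and "C \<equiv> appell_coeff a b b' c"
  shows "x * (1 - x) * S (cshift1 (cshift1 C)) + y * (1 - x) * S (cshift1 (cshift2 C))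
     + (c - (a + b + 1) * x) * S (cshift1 C) - b * y * S (cshift2 C) - a * b * S C = 0"
proof -
  let ?T = "\<lambda>d. \<lambda>(m, n). d m n * x ^ m * y ^ n"
  have sub: "subexponential C" unfolding C_def using c by (rule subexponential_appell_coeff)
  note sub1 = subexponential_cshift1[OF sub]
  have h0: "(?T C has_sum S C) UNIV" unfolding S_def by (rule double_series_has_sum[OF sub xy])
  have h1: "(?T (cshift1 C) has_sum S (cshift1 C)) UNIV" unfolding S_def by (rule double_series_has_sum[OF sub1 xy])
  have e1: "(?T (\<lambda>m n. of_nat m * C m n) has_sum x * S (cshift1 C)) UNIV"
    unfolding S_def by (rule has_sum_euler1[OF sub xy])
  have e2: "(?T (\<lambda>m n. of_nat n * C m n) has_sum y * S (cshift2 C)) UNIV"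
    unfolding S_def by (rule has_sum_euler2[OF sub xy])
  have e11: "(?T (\<lambda>m n. of_nat m * cshift1 C m n) has_sum x * S (cshift1 (cshift1 C))) UNIV"
    unfolding S_def by (rule has_sum_euler1[OF sub1 xy])
  have e12: "(?T (\<lambda>m n. of_nat n * cshift1 C m n) has_sum y * S (cshift1 (cshift2 C))) UNIV"
    unfolding S_def cshift_commute[symmetric] by (rule has_sum_euler2[OF sub1 xy])
  \<comment> \<open>The shift by \<open>x\<close> turns the coefficient
    \<open>m (m + 1) C (m + 1) n\<close> of \<open>e11\<close> into
    \<open>m (m - 1) C m n\<close>.\<close>
  have e11': "(?T (\<lambda>m n. of_nat m * (of_nat m - 1) * C m n) has_sum x * (x * S (cshift1 (cshift1 C)))) UNIV"
    by (rule has_sum_times_fst[where d = "\<lambda>m n. of_nat m * C (Suc m) n"])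
       (use e11 in \<open>simp_all add: cshift1_def mult_ac\<close>)
  have e12': "(?T (\<lambda>m n. of_nat m * of_nat n * C m n) has_sum x * (y * S (cshift1 (cshift2 C)))) UNIV"
    by (rule has_sum_times_fst[where d = "\<lambda>m n. of_nat n * C (Suc m) n"])
       (use e12 in \<open>simp_all add: cshift1_def mult_ac\<close>)
  note sum = has_sum_diff[OF has_sum_diff[OF has_sum_diff[OF has_sum_add[OF
      has_sum_diff[OF has_sum_add[OF e11 e12] has_sum_add[OF e11' e12']]
      has_sum_cmult_right[OF h1, of c]] has_sum_cmult_right[OF e1, of "a + b + 1"]]
      has_sum_cmult_right[OF e2, of b]] has_sum_cmult_right[OF h0, of "a * b"]]
  have "(\<lambda>p. 0) = (\<lambda>p. ?T (\<lambda>m n. of_nat m * cshift1 C m n) p + ?T (\<lambda>m n. of_nat n * cshift1 C m n) p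
     - (?T (\<lambda>m n. of_nat m * (of_nat m - 1) * C m n) p + ?T (\<lambda>m n. of_nat m * of_nat n * C m n) p)
     + c * ?T (cshift1 C) p - (a + b + 1) * ?T (\<lambda>m n. of_nat m * C m n) p
     - b * ?T (\<lambda>m n. of_nat n * C m n) p - a * b * ?T C p)"
  proof (rule ext, clarify)
    fix m n
    have "of_nat (Suc m) * (c + of_nat m + of_nat n) * C (Suc m) n - (a + of_nat m + of_nat n) * (b + of_nat m) * C m n = 0"
      using appell_coeff_Suc(1)[OF c] unfolding C_def by simp
    then have "0 = (of_nat (Suc m) * (c + of_nat m + of_nat n) * C (Suc m) n
        - (a + of_nat m + of_nat n) * (b + of_nat m) * C m n) * (x ^ m * y ^ n)" by simp
    also have "\<dots> = of_nat m * cshift1 C m n * x ^ m * y ^ n + of_nat n * cshift1 C m n * x ^ m * y ^ n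
     - (of_nat m * (of_nat m - 1) * C m n * x ^ m * y ^ n + of_nat m * of_nat n * C m n * x ^ m * y ^ n)
     + c * (cshift1 C m n * x ^ m * y ^ n) - (a + b + 1) * (of_nat m * C m n * x ^ m * y ^ n)
     - b * (of_nat n * C m n * x ^ m * y ^ n) - a * b * (C m n * x ^ m * y ^ n)"
      unfolding cshift1_def by (simp add: algebra_simps)
    finally show "0 = of_nat m * cshift1 C m n * x ^ m * y ^ n + of_nat n * cshift1 C m n * x ^ m * y ^ n
     - (of_nat m * (of_nat m - 1) * C m n * x ^ m * y ^ n + of_nat m * of_nat n * C m n * x ^ m * y ^ n)
     + c * (cshift1 C m n * x ^ m * y ^ n) - (a + b + 1) * (of_nat m * C m n * x ^ m * y ^ n)
     - b * (of_nat n * C m n * x ^ m * y ^ n) - a * b * (C m n * x ^ m * y ^ n)" .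
  qed
  \<comment> \<open>The combined series vanishes term by term, so uniqueness of sums makes its value
    zero.\<close>
  from has_sum_unique[OF sum[folded this] has_sum_0] show ?thesis
    by (simp add: algebra_simps)
qed

text \<open>The first equation with the two variables exchanged, together with \<open>b\<close> and
  \<open>b'\<close>.\<close>

lemma appell_series_equation2:
  fixes a b b' c x y :: complex
  assumes c: "c \<notin> \<int>\<^sub>\<le>\<^sub>0" and xy: "x \<in> ball 0 1" "y \<in> ball 0 1"
  defines "S \<equiv> \<lambda>d. double_series d (x, y)" and "C \<equiv> appell_coeff a b b' c"
  shows "y * (1 - y) * S (cshift2 (cshift2 C)) + x * (1 - y) * S (cshift1 (cshift2 C))
     + (c - (a + b' + 1) * y) * S (cshift2 C) - b' * x * S (cshift1 C) - a * b' * S C = 0"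
  using appell_series_equation1[OF c xy(2,1), of a b' b]
  unfolding ctranspose_appell_coeff[symmetric, of a b' b] cshift_ctranspose double_series_ctranspose cshift_commute
    S_def C_def .

text \<open>The Euler-Poisson-Darboux equation. Multiplying the two recurrences by
  \<open>b + m\<close> and \<open>b' + n\<close> makes their right-hand sides equal; cancelling the
  nonzero factor \<open>c + m + n\<close> leaves
  \<open>(b + m) cshift2 C = (b' + n) cshift1 C\<close>.\<close>

lemma appell_series_equation3:
  fixes a b b' c x y :: complex
  assumes c: "c \<notin> \<int>\<^sub>\<le>\<^sub>0" and xy: "x \<in> ball 0 1" "y \<in> ball 0 1"
  defines "S \<equiv> \<lambda>d. double_series d (x, y)" and "C \<equiv> appell_coeff a b b' c"
  shows "(x - y) * S (cshift1 (cshift2 C)) - b' * S (cshift1 C) + b * S (cshift2 C) = 0"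
proof -
  let ?T = "\<lambda>d. \<lambda>(m, n). d m n * x ^ m * y ^ n"
  have sub: "subexponential C" unfolding C_def using c by (rule subexponential_appell_coeff)
  note sub1 = subexponential_cshift1[OF sub] and sub2 = subexponential_cshift2[OF sub]
  have h1: "(?T (cshift1 C) has_sum S (cshift1 C)) UNIV" unfolding S_def by (rule double_series_has_sum[OF sub1 xy])
  have h2: "(?T (cshift2 C) has_sum S (cshift2 C)) UNIV" unfolding S_def by (rule double_series_has_sum[OF sub2 xy])
  have e1: "(?T (\<lambda>m n. of_nat m * cshift2 C m n) has_sum x * S (cshift1 (cshift2 C))) UNIV"
    unfolding S_def by (rule has_sum_euler1[OF sub2 xy])
  have e2: "(?T (\<lambda>m n. of_nat n * cshift1 C m n) has_sum y * S (cshift1 (cshift2 C))) UNIV"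
    unfolding S_def cshift_commute[symmetric] by (rule has_sum_euler2[OF sub1 xy])
  note sum = has_sum_add[OF has_sum_diff[OF has_sum_diff[OF e1 e2]
      has_sum_cmult_right[OF h1, of b']] has_sum_cmult_right[OF h2, of b]]
  have "(\<lambda>p. 0) = (\<lambda>p. ?T (\<lambda>m n. of_nat m * cshift2 C m n) p - ?T (\<lambda>m n. of_nat n * cshift1 C m n) p
     - b' * ?T (cshift1 C) p + b * ?T (cshift2 C) p)"
  proof (rule ext, clarify)
    fix m n
    have nz: "c + of_nat m + of_nat n \<noteq> 0"
      using add_of_nat_nonzero[OF c, of "m + n"] by (simp add: add.assoc)
    have "(c + of_nat m + of_nat n) * ((b + of_nat m) * cshift2 C m n) =
        (c + of_nat m + of_nat n) * ((b' + of_nat n) * cshift1 C m n)"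
      using arg_cong[OF appell_coeff_Suc(2)[OF c, of n m a b b'], of "\<lambda>t. (b + of_nat m) * t"]
        arg_cong[OF appell_coeff_Suc(1)[OF c, of m n a b b'], of "\<lambda>t. (b' + of_nat n) * t"]
      unfolding C_def cshift1_def cshift2_def by (simp only: mult_ac)
    then have "(b + of_nat m) * cshift2 C m n = (b' + of_nat n) * cshift1 C m n" using nz by simp
    then have "0 = ((b + of_nat m) * cshift2 C m n - (b' + of_nat n) * cshift1 C m n) * (x ^ m * y ^ n)" by simp
    also have "\<dots> = of_nat m * cshift2 C m n * x ^ m * y ^ n - of_nat n * cshift1 C m n * x ^ m * y ^ n
     - b' * (cshift1 C m n * x ^ m * y ^ n) + b * (cshift2 C m n * x ^ m * y ^ n)"
      by (simp add: algebra_simps)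
    finally show "0 = of_nat m * cshift2 C m n * x ^ m * y ^ n - of_nat n * cshift1 C m n * x ^ m * y ^ n
     - b' * (cshift1 C m n * x ^ m * y ^ n) + b * (cshift2 C m n * x ^ m * y ^ n)" .
  qed
  from has_sum_unique[OF sum[folded this] has_sum_0] show ?thesis
    by (simp add: algebra_simps)
qed

section \<open>The identity theorem and analytic continuation\<close>

lemma holomorphic2_diff:
  assumes "f holomorphic2_on D" "g holomorphic2_on D" "open D"
  shows "(\<lambda>v. f v - g v) holomorphic2_on D"
  using holomorphic2_add[OF assms(1) holomorphic2_mult[OF holomorphic2_const[of "- 1"] assms(2,3)] assms(3)]
  by simp

lemma holomorphic2_fst: "fst holomorphic2_on D" and holomorphic2_snd: "snd holomorphic2_on D"
  using holomorphic2_linear[of 1 0 0 D] holomorphic2_linear[of 0 1 0 D]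
  by (simp_all add: case_prod_unfold)

lemma holomorphic2_section1:
  assumes "f holomorphic2_on D" "open D" "A \<times> {y} \<subseteq> D"
  shows "(\<lambda>t. f (t, y)) holomorphic_on A"
proof (rule holomorphic_onI)
  fix x assume "x \<in> A"
  then have "((\<lambda>t. f (t, y)) has_field_derivative pd1 f (x, y)) (at x)"
    using assms(3) by (intro holomorphic2_partials[OF assms(1,2)]) auto
  then show "(\<lambda>t. f (t, y)) field_differentiable at x within A"
    unfolding field_differentiable_def using has_field_derivative_at_within by blast
qed

lemma holomorphic2_section2:
  assumes "f holomorphic2_on D" "open D" "{x} \<times> B \<subseteq> D"
  shows "(\<lambda>t. f (x, t)) holomorphic_on B"
proof (rule holomorphic_onI)
  fix y assume "y \<in> B"
  then have "((\<lambda>t. f (x, t)) has_field_derivative pd2 f (x, y)) (at y)"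
    using assms(3) by (intro holomorphic2_partials[OF assms(1,2)]) auto
  then show "(\<lambda>t. f (x, t)) field_differentiable at y within B"
    unfolding field_differentiable_def using has_field_derivative_at_within by blast
qed

text \<open>The one-variable identity theorem used twice: horizontal slices through a small bidisc
  extend the zeros to a full strip, and then vertical slices through the strip cover the large
  bidisc.\<close>

lemma holomorphic2_identity_polydisc:
  assumes f: "f holomorphic2_on D" "open D" and sub: "ball x0 r \<times> ball y0 r \<subseteq> D"
    and U: "open U" "q \<in> U \<inter> ball x0 r \<times> ball y0 r" "\<And>v. v \<in> U \<Longrightarrow> f v = 0"
    and v: "v \<in> ball x0 r \<times> ball y0 r"
  shows "f v = 0"
proof -
  obtain q1 q2 where q: "q = (q1, q2)" by (cases q)
  have "open (U \<inter> ball x0 r \<times> ball y0 r)" using U(1) by (intro open_Int open_Times) auto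
  then obtain e where e: "e > 0" "cball q1 e \<times> cball q2 e \<subseteq> U \<inter> ball x0 r \<times> ball y0 r"
    using open_contains_cball_times U(2) unfolding q by blast
  have q1: "ball q1 e \<subseteq> ball x0 r" and q2: "ball q2 e \<subseteq> ball y0 r"
    and 0: "\<And>s t. s \<in> ball q1 e \<Longrightarrow> t \<in> ball q2 e \<Longrightarrow> f (s, t) = 0"
  proof -
    have c: "s \<in> ball x0 r \<and> t \<in> ball y0 r \<and> f (s, t) = 0" if "s \<in> ball q1 e" "t \<in> ball q2 e" for s t
    proof -
      have "(s, t) \<in> cball q1 e \<times> cball q2 e" using that by simp
      then show ?thesis using e(2) U(3) by blast
    qed
    have "q1 \<in> ball q1 e" "q2 \<in> ball q2 e" using e(1) by simp_all
    then show "ball q1 e \<subseteq> ball x0 r" "ball q2 e \<subseteq> ball y0 r"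
      "\<And>s t. s \<in> ball q1 e \<Longrightarrow> t \<in> ball q2 e \<Longrightarrow> f (s, t) = 0"
      using c by blast+
  qed
  have 1: "f (s, t) = 0" if "t \<in> ball q2 e" "s \<in> ball x0 r" for s t
  proof (rule analytic_continuation_open[where s = "ball q1 e" and s' = "ball x0 r" and g = "\<lambda>_. 0" and f = "\<lambda>s. f (s, t)"])
    have "ball x0 r \<times> {t} \<subseteq> D" using sub q2 that(1) by blast
    then show "(\<lambda>s. f (s, t)) holomorphic_on ball x0 r" by (rule holomorphic2_section1[OF f])
  qed (use e(1) q1 0 that in auto)
  obtain s t where st: "v = (s, t)" by (cases v)
  have "f (s, t) = 0"
  proof (rule analytic_continuation_open[where s = "ball q2 e" and s' = "ball y0 r" and g = "\<lambda>_. 0" and f = "\<lambda>t. f (s, t)"])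
    have "{s} \<times> ball y0 r \<subseteq> D" using sub v st by blast
    then show "(\<lambda>t. f (s, t)) holomorphic_on ball y0 r" by (rule holomorphic2_section2[OF f])
  qed (use e(1) q2 1 v st in auto)
  then show ?thesis by (simp add: st)
qed

text \<open>The interior of the zero set is relatively closed in \<open>D\<close>: a bidisc in
  \<open>D\<close> that meets it lies entirely inside it, by the previous lemma. Connectedness does
  the rest.\<close>

lemma holomorphic2_identity:
  assumes f: "f holomorphic2_on D" "open D" "connected D"
    and U: "open U" "U \<noteq> {}" "U \<subseteq> D" "\<And>v. v \<in> U \<Longrightarrow> f v = 0" and "v \<in> D"
  shows "f v = 0"
proof -
  define Z where "Z = interior {v \<in> D. f v = 0}"
  have Z0: "f v = 0" if "v \<in> Z" for v using that interior_subset unfolding Z_def by blast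
  have "open (D - Z)"
    unfolding open_subopen[of "D - Z"]
  proof (rule ballI)
    fix p assume p: "p \<in> D - Z"
    obtain x y where xy: "p = (x, y)" by (cases p)
    obtain r where r: "r > 0" "cball x r \<times> cball y r \<subseteq> D"
      using open_contains_cball_times f(2) p unfolding xy by blast
    let ?B = "ball x r \<times> ball y r"
    have B: "?B \<subseteq> D" "open ?B" "p \<in> ?B"
      using r ball_subset_cball[of x r] ball_subset_cball[of y r] by (auto simp: xy intro: open_Times)
    have "?B \<inter> Z = {}"
    proof (rule ccontr)
      assume "?B \<inter> Z \<noteq> {}"
      then obtain q where q: "q \<in> Z \<inter> ?B" by blast
      have "f v = 0" if "v \<in> ?B" for v
        by (rule holomorphic2_identity_polydisc[OF f(1,2) B(1) _ q Z0 that]) (simp add: Z_def)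
      then have "?B \<subseteq> Z" unfolding Z_def using B by (intro interior_maximal) auto
      then show False using p B(3) by blast
    qed
    then show "\<exists>T. open T \<and> p \<in> T \<and> T \<subseteq> D - Z" using B by blast
  qed
  moreover have "open Z" "Z \<subseteq> D" unfolding Z_def using interior_subset by auto
  moreover have "U \<subseteq> Z" unfolding Z_def using U by (intro interior_maximal) auto
  ultimately have "D - Z = {}"
    using connectedD[OF f(3), of Z "D - Z"] U(2,3) by blast
  then show ?thesis using Z0 \<open>v \<in> D\<close> by blast
qed

section \<open>Appell's operators and their behaviour under continuation\<close>

definition appell_op1 :: "complex \<Rightarrow> complex \<Rightarrow> complex \<Rightarrow> (complex \<times> complex \<Rightarrow> complex) \<Rightarrow> complex \<times> complex \<Rightarrow> complex" where
  "appell_op1 a b c f v = fst v * (1 - fst v) * pd1 (pd1 f) v + snd v * (1 - fst v) * pd1 (pd2 f) v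
     + (c - (a + b + 1) * fst v) * pd1 f v - b * snd v * pd2 f v - a * b * f v"

definition appell_op2 :: "complex \<Rightarrow> complex \<Rightarrow> complex \<Rightarrow> (complex \<times> complex \<Rightarrow> complex) \<Rightarrow> complex \<times> complex \<Rightarrow> complex" where
  "appell_op2 a b' c f v = snd v * (1 - snd v) * pd2 (pd2 f) v + fst v * (1 - snd v) * pd1 (pd2 f) v
     + (c - (a + b' + 1) * snd v) * pd2 f v - b' * fst v * pd1 f v - a * b' * f v"

definition appell_op3 :: "complex \<Rightarrow> complex \<Rightarrow> (complex \<times> complex \<Rightarrow> complex) \<Rightarrow> complex \<times> complex \<Rightarrow> complex" where
  "appell_op3 b b' f v = (fst v - snd v) * pd1 (pd2 f) v - b' * pd1 f v + b * pd2 f v"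

definition solves_appell_system :: "complex \<Rightarrow> complex \<Rightarrow> complex \<Rightarrow> complex \<Rightarrow> (complex \<times> complex) set \<Rightarrow>
    (complex \<times> complex \<Rightarrow> complex) \<Rightarrow> bool" where
  "solves_appell_system a b b' c D f \<longleftrightarrow> f holomorphic2_on D \<and>
     (\<forall>v\<in>D. appell_op1 a b c f v = 0 \<and> appell_op2 a b' c f v = 0 \<and> appell_op3 b b' f v = 0)"

lemma appell_op_holomorphic2:
  assumes "f holomorphic2_on D" "open D"
  shows "appell_op1 a b c f holomorphic2_on D" "appell_op2 a b' c f holomorphic2_on D"
    "appell_op3 b b' f holomorphic2_on D"
  unfolding appell_op1_def appell_op2_def appell_op3_def
  by (intro holomorphic2_add holomorphic2_diff holomorphic2_mult holomorphic2_const holomorphic2_fst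
      holomorphic2_snd holomorphic2_pd assms)+

lemma appell_op_cong:
  assumes "\<forall>v\<in>D. f v = g v" "open D" "v \<in> D"
  shows "appell_op1 a b c f v = appell_op1 a b c g v" "appell_op2 a b' c f v = appell_op2 a b' c g v"
    "appell_op3 b b' f v = appell_op3 b b' g v"
proof -
  have 1: "pd1 f v = pd1 g v" "pd2 f v = pd2 g v" if "v \<in> D" for v
    using assms(1) by (auto intro: pd1_cong[OF _ assms(2) that] pd2_cong[OF _ assms(2) that])
  have 2: "pd1 (pd1 f) v = pd1 (pd1 g) v" "pd1 (pd2 f) v = pd1 (pd2 g) v" "pd2 (pd2 f) v = pd2 (pd2 g) v"
    using 1 by (auto intro: pd1_cong[OF _ assms(2,3)] pd2_cong[OF _ assms(2,3)])
  show "appell_op1 a b c f v = appell_op1 a b c g v" "appell_op2 a b' c f v = appell_op2 a b' c g v"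
    "appell_op3 b b' f v = appell_op3 b b' g v"
    using assms(1,3) 1[OF assms(3)] 2 by (simp_all add: appell_op1_def appell_op2_def appell_op3_def)
qed

lemma appell_series_solves:
  fixes a b b' c :: complex
  assumes c: "c \<notin> \<int>\<^sub>\<le>\<^sub>0" and v: "v \<in> ball 0 1 \<times> ball 0 1"
  defines "f \<equiv> double_series (appell_coeff a b b' c)"
  shows "appell_op1 a b c f v = 0" "appell_op2 a b' c f v = 0" "appell_op3 b b' f v = 0"
proof -
  let ?C = "appell_coeff a b b' c"
  have sub: "subexponential ?C" using c by (rule subexponential_appell_coeff)
  note sub1 = subexponential_cshift1[OF sub] and sub2 = subexponential_cshift2[OF sub]
  have op: "open (ball 0 1 \<times> ball 0 1 :: (complex \<times> complex) set)" by (intro open_Times) auto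
  have pd: "pd1 f v = double_series (cshift1 ?C) v" "pd2 f v = double_series (cshift2 ?C) v"
    unfolding f_def by (rule pd1_double_series[OF sub v] pd2_double_series[OF sub v])+
  have "pd1 (pd1 f) v = pd1 (double_series (cshift1 ?C)) v"
    unfolding f_def by (rule pd1_cong[OF pd1_double_series[OF sub] op v])
  then have pd11: "pd1 (pd1 f) v = double_series (cshift1 (cshift1 ?C)) v"
    using pd1_double_series[OF sub1 v] by simp
  have "pd1 (pd2 f) v = pd1 (double_series (cshift2 ?C)) v"
    unfolding f_def by (rule pd1_cong[OF pd2_double_series[OF sub] op v])
  then have pd12: "pd1 (pd2 f) v = double_series (cshift1 (cshift2 ?C)) v"
    using pd1_double_series[OF sub2 v] by simp
  have "pd2 (pd2 f) v = pd2 (double_series (cshift2 ?C)) v"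
    unfolding f_def by (rule pd2_cong[OF pd2_double_series[OF sub] op v])
  then have pd22: "pd2 (pd2 f) v = double_series (cshift2 (cshift2 ?C)) v"
    using pd2_double_series[OF sub2 v] by simp
  obtain x y where xy: "v = (x, y)" by (cases v)
  have xy': "x \<in> ball 0 1" "y \<in> ball 0 1" using v by (auto simp: xy)
  show "appell_op1 a b c f v = 0"
    unfolding appell_op1_def pd pd11 pd12 unfolding f_def xy fst_conv snd_conv
    by (rule appell_series_equation1[OF c xy'])
  show "appell_op2 a b' c f v = 0"
    unfolding appell_op2_def pd pd22 pd12 unfolding f_def xy fst_conv snd_conv
    by (rule appell_series_equation2[OF c xy'])
  show "appell_op3 b b' f v = 0"
    unfolding appell_op3_def pd pd12 unfolding f_def xy fst_conv snd_conv
    by (rule appell_series_equation3[OF c xy'])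
qed

lemma appell_F1_branch_solves:
  assumes "appell_F1_branch a b b' c D f" and c: "c \<notin> \<int>\<^sub>\<le>\<^sub>0"
  shows "open D \<and> solves_appell_system a b b' c D f"
  using assms(1)
proof (induction rule: appell_F1_branch.induct)
  case (series D f)
  let ?S = "double_series (appell_coeff a b b' c)"
  have eq: "\<forall>v\<in>D. f v = ?S v"
    using series(4) by (auto simp: appell_F1_eq_double_series)
  have "?S holomorphic2_on D"
    unfolding holomorphic2_on_def
    using holomorphic2_derivative[OF double_series_holomorphic2[OF subexponential_appell_coeff[OF c]]]
      series(3) has_derivative_at_withinI open_Times[OF open_ball open_ball] by blast
  then have "f holomorphic2_on D" by (rule holomorphic2_cong) (use eq in blast)
  moreover have "appell_op1 a b c f v = 0 \<and> appell_op2 a b' c f v = 0 \<and> appell_op3 b b' f v = 0" if "v \<in> D" for v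
  proof -
    have "v \<in> ball 0 1 \<times> ball 0 1" using series(3) that by blast
    from appell_series_solves[OF c this] appell_op_cong[OF eq series(1) that] show ?thesis by simp
  qed
  ultimately show ?case using series(1) by (simp add: solves_appell_system_def)
next
  case (continuation D f D' f' U)
  have eq: "\<forall>v\<in>U. f' v = f v" using continuation.hyps by blast
  have U: "open U" "U \<noteq> {}" "U \<subseteq> D'" "U \<subseteq> D" using continuation by auto
  have 0: "appell_op1 a b c f' v = 0 \<and> appell_op2 a b' c f' v = 0 \<and> appell_op3 b b' f' v = 0" if "v \<in> U" for v
  proof -
    have "appell_op1 a b c f v = 0 \<and> appell_op2 a b' c f v = 0 \<and> appell_op3 b b' f v = 0"
      using continuation.IH U(4) that by (auto simp: solves_appell_system_def)
    with appell_op_cong[OF eq U(1) that] show ?thesis by simp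
  qed
  \<comment> \<open>The identity theorem is applied not to \<open>f'\<close> but to the three
    functions that the operators make of it; they vanish on \<open>U\<close>.\<close>
  note hol = appell_op_holomorphic2[OF continuation(4,2)]
  have "appell_op1 a b c f' v = 0 \<and> appell_op2 a b' c f' v = 0 \<and> appell_op3 b b' f' v = 0" if "v \<in> D'" for v
    using 0 holomorphic2_identity[OF hol(1) continuation(2,3) U(1-3) _ that]
      holomorphic2_identity[OF hol(2) continuation(2,3) U(1-3) _ that]
      holomorphic2_identity[OF hol(3) continuation(2,3) U(1-3) _ that] by blast
  then show ?case using continuation(2,4) by (simp add: solves_appell_system_def)
qed

text \<open>The right-hand sides are the coefficients of Appell's first equation for the parameters
  \<open>\<alpha> + \<beta> - 1\<close>, \<open>-\<gamma>\<close>, \<open>-\<gamma>\<close>,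
  \<open>\<alpha> - \<gamma>\<close> (the third one moved to the form \<open>-a b\<close>), after
  the mixed derivative in \<open>y (1 - x) f_12\<close> has been replaced by means of the third
  equation. The \<open>w\<close>-system is thus Appell's system divided by
  \<open>x (1 - x)\<close>.\<close>

lemma appell_coefficients:
  fixes x y \<alpha> \<beta> \<gamma> :: complex
  assumes "x \<noteq> 0" "x \<noteq> 1" "x \<noteq> y"
  shows "x * (1 - x) * (\<alpha> / x + \<beta> / (x - 1) + (- \<gamma>) / (x - y)) =
      (\<alpha> - \<gamma>) - (\<alpha> + \<beta> - 1 + (- \<gamma>) + 1) * x + y * (1 - x) * (- \<gamma> / (x - y))"
    and "x * (1 - x) * (\<gamma> * y * (y - 1) / (x * (x - 1) * (x - y))) = \<gamma> * y + y * (1 - x) * (\<gamma> / (x - y))"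
    and "x * (1 - x) * ((1 - \<alpha> - \<beta>) * \<gamma> / (x * (x - 1))) = (\<alpha> + \<beta> - 1) * \<gamma>"
proof -
  define j where "j = inverse (x - 1)"
  define k where "k = inverse (x - y)"
  have r: "x * inverse x = 1" "(x - 1) * j = 1" "(x - y) * k = 1"
    using assms by (simp_all add: j_def k_def)
  have "x * (1 - x) * (\<alpha> / x + \<beta> / (x - 1) + (- \<gamma>) / (x - y)) =
      \<alpha> * (1 - x) * (x * inverse x) - \<beta> * x * ((x - 1) * j) - \<gamma> * (1 - x) * ((x - y) * k) + y * (1 - x) * (- \<gamma> * k)"
    unfolding divide_inverse j_def[symmetric] k_def[symmetric] by (simp add: algebra_simps)
  then show "x * (1 - x) * (\<alpha> / x + \<beta> / (x - 1) + (- \<gamma>) / (x - y)) =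
      (\<alpha> - \<gamma>) - (\<alpha> + \<beta> - 1 + (- \<gamma>) + 1) * x + y * (1 - x) * (- \<gamma> / (x - y))"
    unfolding r by (simp add: divide_inverse k_def[symmetric] algebra_simps)
  have "x * (1 - x) * (\<gamma> * y * (y - 1) / (x * (x - 1) * (x - y))) =
      (x * inverse x) * ((x - 1) * j) * (\<gamma> * y * ((x - y) * k) + y * (1 - x) * (\<gamma> * k))"
    unfolding divide_inverse inverse_mult_distrib j_def[symmetric] k_def[symmetric] by (simp add: algebra_simps)
  then show "x * (1 - x) * (\<gamma> * y * (y - 1) / (x * (x - 1) * (x - y))) = \<gamma> * y + y * (1 - x) * (\<gamma> / (x - y))"
    unfolding r by (simp add: divide_inverse k_def[symmetric])
  have "x * (1 - x) * ((1 - \<alpha> - \<beta>) * \<gamma> / (x * (x - 1))) = (x * inverse x) * ((x - 1) * j) * ((\<alpha> + \<beta> - 1) * \<gamma>)"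
    unfolding divide_inverse inverse_mult_distrib j_def[symmetric] by (simp add: algebra_simps)
  then show "x * (1 - x) * ((1 - \<alpha> - \<beta>) * \<gamma> / (x * (x - 1))) = (\<alpha> + \<beta> - 1) * \<gamma>"
    unfolding r by simp
qed

lemma solves_w_systemI_appell:
  assumes f: "solves_appell_system (\<alpha> + \<beta> - 1) (- \<gamma>) (- \<gamma>) (\<alpha> - \<gamma>) D f" and D: "nonsingular D"
  shows "solves_w_system \<alpha> \<beta> \<gamma> D f"
  unfolding solves_w_system_def
proof (rule conjI, use f in \<open>simp add: solves_appell_system_def\<close>, clarify, intro conjI)
  fix x y assume v: "(x, y) \<in> D"
  have ne: "x \<noteq> 0" "x \<noteq> 1" "y \<noteq> 0" "y \<noteq> 1" "x \<noteq> y" "y \<noteq> x" using D v by (auto simp: nonsingular_def)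
  have E1: "x * (1 - x) * pd1 (pd1 f) (x, y) + y * (1 - x) * pd1 (pd2 f) (x, y)
     + ((\<alpha> - \<gamma>) - (\<alpha> + \<beta> - 1 + (- \<gamma>) + 1) * x) * pd1 f (x, y) - (- \<gamma>) * y * pd2 f (x, y)
     - (\<alpha> + \<beta> - 1) * (- \<gamma>) * f (x, y) = 0"
    and E2: "y * (1 - y) * pd2 (pd2 f) (x, y) + x * (1 - y) * pd1 (pd2 f) (x, y)
     + ((\<alpha> - \<gamma>) - (\<alpha> + \<beta> - 1 + (- \<gamma>) + 1) * y) * pd2 f (x, y) - (- \<gamma>) * x * pd1 f (x, y)
     - (\<alpha> + \<beta> - 1) * (- \<gamma>) * f (x, y) = 0"
    and E3: "(x - y) * pd1 (pd2 f) (x, y) - (- \<gamma>) * pd1 f (x, y) + (- \<gamma>) * pd2 f (x, y) = 0"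
    using f v unfolding solves_appell_system_def appell_op1_def appell_op2_def appell_op3_def by auto
  have "(x - y) * pd1 (pd2 f) (x, y) = - \<gamma> * pd1 f (x, y) + \<gamma> * pd2 f (x, y)"
    using E3 by (simp add: algebra_simps add_eq_0_iff)
  then have "pd1 (pd2 f) (x, y) = (- \<gamma> * pd1 f (x, y) + \<gamma> * pd2 f (x, y)) / (x - y)"
    using ne by (simp add: nonzero_eq_divide_eq mult.commute)
  then show 3: "pd1 (pd2 f) (x, y) = (- \<gamma>) / (x - y) * pd1 f (x, y) + \<gamma> / (x - y) * pd2 f (x, y)"
    by (simp add: diff_divide_distrib)
  \<comment> \<open>The mixed equation is put over \<open>y - x\<close>, as required by
    \<open>appell_coefficients\<close> with the variables exchanged.\<close>
  have "\<gamma> / (x - y) = - \<gamma> / (y - x)" "- \<gamma> / (x - y) = \<gamma> / (y - x)"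
    by (metis minus_diff_eq minus_divide_divide minus_minus)+
  then have mixed': "pd1 (pd2 f) (x, y) = \<gamma> / (y - x) * pd1 f (x, y) + - \<gamma> / (y - x) * pd2 f (x, y)"
    using 3 by simp
  \<comment> \<open>Distributes without normalising, so that the products of
    \<open>x (1 - x)\<close> with a coefficient stay intact for rewriting.\<close>
  have dist: "k * (f11 + p * f1 + q * f2 + s * f0) = k * f11 + (k * p) * f1 + (k * q) * f2 + (k * s) * f0"
    for k f11 f1 f2 f0 p q s :: complex
    by (simp add: algebra_simps)
  have "x * (1 - x) * (pd1 (pd1 f) (x, y) + (\<alpha> / x + \<beta> / (x - 1) + (- \<gamma>) / (x - y)) * pd1 f (x, y)
         + (\<gamma> * y * (y - 1)) / (x * (x - 1) * (x - y)) * pd2 f (x, y)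
         + ((1 - \<alpha> - \<beta>) * \<gamma>) / (x * (x - 1)) * f (x, y)) =
       x * (1 - x) * pd1 (pd1 f) (x, y) + (x * (1 - x) * (\<alpha> / x + \<beta> / (x - 1) + (- \<gamma>) / (x - y))) * pd1 f (x, y)
         + (x * (1 - x) * ((\<gamma> * y * (y - 1)) / (x * (x - 1) * (x - y)))) * pd2 f (x, y)
         + (x * (1 - x) * (((1 - \<alpha> - \<beta>) * \<gamma>) / (x * (x - 1)))) * f (x, y)"
    by (rule dist)
  also have "\<dots> = 0"
    using E1 unfolding appell_coefficients[OF ne(1,2,5)] 3 by (simp add: algebra_simps)
  finally show "pd1 (pd1 f) (x, y) + (\<alpha> / x + \<beta> / (x - 1) + (- \<gamma>) / (x - y)) * pd1 f (x, y)
         + (\<gamma> * y * (y - 1)) / (x * (x - 1) * (x - y)) * pd2 f (x, y)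
         + ((1 - \<alpha> - \<beta>) * \<gamma>) / (x * (x - 1)) * f (x, y) = 0"
    using ne by (metis mult_eq_0_iff right_minus_eq)
  have "y * (1 - y) * (pd2 (pd2 f) (x, y) + (\<alpha> / y + \<beta> / (y - 1) + (- \<gamma>) / (y - x)) * pd2 f (x, y)
         + (\<gamma> * x * (x - 1)) / (y * (y - 1) * (y - x)) * pd1 f (x, y)
         + ((1 - \<alpha> - \<beta>) * \<gamma>) / (y * (y - 1)) * f (x, y)) =
       y * (1 - y) * pd2 (pd2 f) (x, y) + (y * (1 - y) * (\<alpha> / y + \<beta> / (y - 1) + (- \<gamma>) / (y - x))) * pd2 f (x, y)
         + (y * (1 - y) * ((\<gamma> * x * (x - 1)) / (y * (y - 1) * (y - x)))) * pd1 f (x, y)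
         + (y * (1 - y) * (((1 - \<alpha> - \<beta>) * \<gamma>) / (y * (y - 1)))) * f (x, y)"
    by (rule dist)
  also have "\<dots> = 0"
    using E2 unfolding appell_coefficients[OF ne(3,4,6)] mixed' by (simp add: algebra_simps)
  finally show "pd2 (pd2 f) (x, y) + (\<alpha> / y + \<beta> / (y - 1) + (- \<gamma>) / (y - x)) * pd2 f (x, y)
         + (\<gamma> * x * (x - 1)) / (y * (y - 1) * (y - x)) * pd1 f (x, y)
         + ((1 - \<alpha> - \<beta>) * \<gamma>) / (y * (y - 1)) * f (x, y) = 0"
    using ne by (metis mult_eq_0_iff right_minus_eq)
qed

lemma solves_w_system_linear:
  assumes f: "solves_w_system \<alpha> \<beta> \<gamma> D f" and g: "solves_w_system \<alpha> \<beta> \<gamma> D g" and "open D"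
  shows "solves_w_system \<alpha> \<beta> \<gamma> D (\<lambda>v. C1 * f v + C2 * g v)"
proof -
  let ?w = "\<lambda>v. C1 * f v + C2 * g v"
  have lin: "(\<lambda>v. C1 * f v + C2 * g v) holomorphic2_on D"
    "v \<in> D \<Longrightarrow> pd1 (\<lambda>v. C1 * f v + C2 * g v) v = C1 * pd1 f v + C2 * pd1 g v"
    "v \<in> D \<Longrightarrow> pd2 (\<lambda>v. C1 * f v + C2 * g v) v = C1 * pd2 f v + C2 * pd2 g v"
    if "f holomorphic2_on D" "g holomorphic2_on D" for f g v
    using that \<open>open D\<close>
    by (simp_all add: holomorphic2_add holomorphic2_mult holomorphic2_const pd_const
        pd1_add[OF holomorphic2_mult holomorphic2_mult] pd2_add[OF holomorphic2_mult holomorphic2_mult]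
        pd1_mult[where D = D] pd2_mult[where D = D])
  have hol: "f holomorphic2_on D" "g holomorphic2_on D" using f g by (simp_all add: solves_w_system_def)
  note hol' = holomorphic2_pd[OF hol(1) \<open>open D\<close>] holomorphic2_pd[OF hol(2) \<open>open D\<close>]
  have pd: "pd1 ?w v = C1 * pd1 f v + C2 * pd1 g v" "pd2 ?w v = C1 * pd2 f v + C2 * pd2 g v" if "v \<in> D" for v
    using lin[OF hol] that by blast+
  have pdpd: "pd1 (pd1 ?w) v = C1 * pd1 (pd1 f) v + C2 * pd1 (pd1 g) v"
    "pd1 (pd2 ?w) v = C1 * pd1 (pd2 f) v + C2 * pd1 (pd2 g) v"
    "pd2 (pd2 ?w) v = C1 * pd2 (pd2 f) v + C2 * pd2 (pd2 g) v" if "v \<in> D" for v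
    using pd1_cong[OF pd(1) \<open>open D\<close> that] pd1_cong[OF pd(2) \<open>open D\<close> that] pd2_cong[OF pd(2) \<open>open D\<close> that]
      lin(2)[OF hol'(1,3) that] lin(2)[OF hol'(2,4) that] lin(3)[OF hol'(2,4) that] by simp_all
  show ?thesis unfolding solves_w_system_def
  proof (rule conjI[OF lin(1)[OF hol]], clarify, intro conjI)
    fix x y assume v: "(x, y) \<in> D"
    have comb: "C1 * f11 + C2 * g11 + p * (C1 * f1 + C2 * g1) + q * (C1 * f2 + C2 * g2) + s * (C1 * f0 + C2 * g0) = 0"
      if "f11 + p * f1 + q * f2 + s * f0 = 0" "g11 + p * g1 + q * g2 + s * g0 = 0"
      for f11 g11 f1 g1 f2 g2 f0 g0 p q s :: complex
    proof -
      have "C1 * f11 + C2 * g11 + p * (C1 * f1 + C2 * g1) + q * (C1 * f2 + C2 * g2) + s * (C1 * f0 + C2 * g0) =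
        C1 * (f11 + p * f1 + q * f2 + s * f0) + C2 * (g11 + p * g1 + q * g2 + s * g0)"
        by (simp add: algebra_simps)
      then show ?thesis unfolding that by simp
    qed
    show "pd1 (pd1 ?w) (x, y) + (\<alpha> / x + \<beta> / (x - 1) + (- \<gamma>) / (x - y)) * pd1 ?w (x, y)
         + (\<gamma> * y * (y - 1)) / (x * (x - 1) * (x - y)) * pd2 ?w (x, y)
         + ((1 - \<alpha> - \<beta>) * \<gamma>) / (x * (x - 1)) * ?w (x, y) = 0"
      unfolding pd[OF v] pdpd[OF v]
      by (rule comb) (use f g v in \<open>auto simp only: solves_w_system_def\<close>)
    show "pd2 (pd2 ?w) (x, y) + (\<alpha> / y + \<beta> / (y - 1) + (- \<gamma>) / (y - x)) * pd2 ?w (x, y)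
         + (\<gamma> * x * (x - 1)) / (y * (y - 1) * (y - x)) * pd1 ?w (x, y)
         + ((1 - \<alpha> - \<beta>) * \<gamma>) / (y * (y - 1)) * ?w (x, y) = 0"
      unfolding pd[OF v] pdpd[OF v]
      by (rule comb) (use f g v in \<open>auto simp only: solves_w_system_def\<close>)
    have "pd1 (pd2 f) (x, y) = (- \<gamma>) / (x - y) * pd1 f (x, y) + \<gamma> / (x - y) * pd2 f (x, y)"
      "pd1 (pd2 g) (x, y) = (- \<gamma>) / (x - y) * pd1 g (x, y) + \<gamma> / (x - y) * pd2 g (x, y)"
      using f g v by (auto simp only: solves_w_system_def)
    then show "pd1 (pd2 ?w) (x, y) = (- \<gamma>) / (x - y) * pd1 ?w (x, y) + \<gamma> / (x - y) * pd2 ?w (x, y)"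
      unfolding pd[OF v] pdpd[OF v] by (simp only: distrib_left mult_ac add_ac)
  qed
qed

lemma solves_w_system_zero: "solves_w_system \<alpha> \<beta> \<gamma> D (\<lambda>_. 0)"
proof -
  have "pd1 (\<lambda>_. 0) = (\<lambda>_. 0)" "pd2 (\<lambda>_. 0) = (\<lambda>_. 0)" by (simp_all add: fun_eq_iff pd_const)
  then show ?thesis by (simp add: solves_w_system_def holomorphic2_const case_prod_unfold)
qed

section \<open>The reflection v \<mapsto> 1 - v\<close>

definition reflection :: "complex \<times> complex \<Rightarrow> complex \<times> complex" where
  "reflection v = (1 - fst v, 1 - snd v)"

lemma reflection_reflection [simp]: "reflection (reflection v) = v"
  by (simp add: reflection_def)

lemma open_reflection:
  assumes "open D"
  shows "open (reflection ` D)"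
proof -
  have "reflection ` D = reflection -` D"
  proof (intro equalityI subsetI)
    fix v assume "v \<in> reflection -` D"
    then have "reflection (reflection v) \<in> reflection ` D" by (intro imageI) simp
    then show "v \<in> reflection ` D" by simp
  qed auto
  moreover have "open (reflection -` D)"
    unfolding reflection_def by (rule open_vimage[OF assms]) (intro continuous_intros)
  ultimately show ?thesis by simp
qed

lemma nonsingular_reflection: "nonsingular D \<Longrightarrow> nonsingular (reflection ` D)"
  by (auto simp: nonsingular_def reflection_def)

lemma
  assumes "f holomorphic2_on reflection ` D" "open D"
  shows holomorphic2_reflection: "(\<lambda>v. f (reflection v)) holomorphic2_on D"
    and pd1_reflection: "v \<in> D \<Longrightarrow> pd1 (\<lambda>v. f (reflection v)) v = - pd1 f (reflection v)"
    and pd2_reflection: "v \<in> D \<Longrightarrow> pd2 (\<lambda>v. f (reflection v)) v = - pd2 f (reflection v)"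
proof -
  have *: "((\<lambda>v. f (reflection v)) has_derivative
     (\<lambda>(h, k). - pd1 f (reflection v) * h + - pd2 f (reflection v) * k)) (at v)" if "v \<in> D" for v
  proof -
    have "(reflection has_derivative (\<lambda>h. (- fst h, - snd h))) (at v)"
      unfolding reflection_def by (auto intro!: derivative_eq_intros)
    moreover have "(f has_derivative (\<lambda>(h, k). pd1 f (reflection v) * h + pd2 f (reflection v) * k)) (at (reflection v))"
      using that by (intro holomorphic2_derivative[OF assms(1) open_reflection[OF assms(2)]]) simp
    ultimately have "((\<lambda>v. f (reflection v)) has_derivative
       (\<lambda>h. case (- fst h, - snd h) of (h, k) \<Rightarrow> pd1 f (reflection v) * h + pd2 f (reflection v) * k)) (at v)"
      by (rule has_derivative_compose)
    then show ?thesis by (simp add: case_prod_unfold)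
  qed
  show "(\<lambda>v. f (reflection v)) holomorphic2_on D" by (rule holomorphic2_onI[OF *])
  show "v \<in> D \<Longrightarrow> pd1 (\<lambda>v. f (reflection v)) v = - pd1 f (reflection v)"
    "v \<in> D \<Longrightarrow> pd2 (\<lambda>v. f (reflection v)) v = - pd2 f (reflection v)"
    by (simp_all only: pd_eqI[OF *])
qed

text \<open>Under the reflection the first derivatives change sign, and so do their coefficients
  once \<alpha> and \<beta> are exchanged; second derivatives and zero-order coefficients are
  unchanged. Each equation is therefore carried to the corresponding one.\<close>

lemma solves_w_system_reflection:
  assumes f: "solves_w_system \<beta> \<alpha> \<gamma> (reflection ` D) f" and "open D"
  shows "solves_w_system \<alpha> \<beta> \<gamma> D (\<lambda>v. f (reflection v))"
proof -
  let ?w = "\<lambda>v. f (reflection v)"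
  have hol: "f holomorphic2_on reflection ` D" using f by (simp add: solves_w_system_def)
  note hol' = holomorphic2_pd[OF hol open_reflection[OF \<open>open D\<close>]]
  note pd = pd1_reflection[OF hol \<open>open D\<close>] pd2_reflection[OF hol \<open>open D\<close>]
  have neg: "pd1 (\<lambda>v. - g v) v = - pd1 g v" "pd2 (\<lambda>v. - g v) v = - pd2 g v"
    if "g holomorphic2_on D" "v \<in> D" for g v
    using pd1_mult[OF holomorphic2_const[of "- 1"] that(1) \<open>open D\<close> that(2)]
      pd2_mult[OF holomorphic2_const[of "- 1"] that(1) \<open>open D\<close> that(2)] by (simp_all add: pd_const)
  have pdpd: "pd1 (pd1 ?w) v = pd1 (pd1 f) (reflection v)" "pd1 (pd2 ?w) v = pd1 (pd2 f) (reflection v)"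
    "pd2 (pd2 ?w) v = pd2 (pd2 f) (reflection v)" if v: "v \<in> D" for v
  proof -
    have "pd1 (pd1 ?w) v = pd1 (\<lambda>v. - pd1 f (reflection v)) v"
      "pd1 (pd2 ?w) v = pd1 (\<lambda>v. - pd2 f (reflection v)) v"
      "pd2 (pd2 ?w) v = pd2 (\<lambda>v. - pd2 f (reflection v)) v"
      by (rule pd1_cong[OF pd(1) \<open>open D\<close> v] pd1_cong[OF pd(2) \<open>open D\<close> v] pd2_cong[OF pd(2) \<open>open D\<close> v]; assumption)+
    then show "pd1 (pd1 ?w) v = pd1 (pd1 f) (reflection v)" "pd1 (pd2 ?w) v = pd1 (pd2 f) (reflection v)"
      "pd2 (pd2 ?w) v = pd2 (pd2 f) (reflection v)"
      using neg[OF holomorphic2_reflection[OF hol'(1) \<open>open D\<close>] v] neg[OF holomorphic2_reflection[OF hol'(2) \<open>open D\<close>] v]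
        pd1_reflection[OF hol'(1) \<open>open D\<close> v] pd1_reflection[OF hol'(2) \<open>open D\<close> v] pd2_reflection[OF hol'(2) \<open>open D\<close> v]
      by simp_all
  qed
  show ?thesis unfolding solves_w_system_def
  proof (rule conjI[OF holomorphic2_reflection[OF hol \<open>open D\<close>]], clarify)
    fix x y assume v: "(x, y) \<in> D"
    have r: "reflection (x, y) = (1 - x, 1 - y)" by (simp add: reflection_def)
    have "(1 - x, 1 - y) \<in> reflection ` D" using v r by (metis imageI)
    then have "pd1 (pd1 f) (1 - x, 1 - y)
         + (\<beta> / (1 - x) + \<alpha> / (1 - x - 1) + (- \<gamma>) / (1 - x - (1 - y))) * pd1 f (1 - x, 1 - y)
         + (\<gamma> * (1 - y) * (1 - y - 1)) / ((1 - x) * (1 - x - 1) * (1 - x - (1 - y))) * pd2 f (1 - x, 1 - y)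
         + ((1 - \<beta> - \<alpha>) * \<gamma>) / ((1 - x) * (1 - x - 1)) * f (1 - x, 1 - y) = 0 \<and>
       pd2 (pd2 f) (1 - x, 1 - y)
         + (\<beta> / (1 - y) + \<alpha> / (1 - y - 1) + (- \<gamma>) / (1 - y - (1 - x))) * pd2 f (1 - x, 1 - y)
         + (\<gamma> * (1 - x) * (1 - x - 1)) / ((1 - y) * (1 - y - 1) * (1 - y - (1 - x))) * pd1 f (1 - x, 1 - y)
         + ((1 - \<beta> - \<alpha>) * \<gamma>) / ((1 - y) * (1 - y - 1)) * f (1 - x, 1 - y) = 0 \<and>
       pd1 (pd2 f) (1 - x, 1 - y)
         = (- \<gamma>) / (1 - x - (1 - y)) * pd1 f (1 - x, 1 - y) + \<gamma> / (1 - x - (1 - y)) * pd2 f (1 - x, 1 - y)"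
      using f unfolding solves_w_system_def by blast
    note E = this
    have e: "\<beta> / (1 - s) + \<alpha> / (1 - s - 1) + (- \<gamma>) / (1 - s - (1 - t)) = - (\<alpha> / s + \<beta> / (s - 1) + (- \<gamma>) / (s - t))"
      "\<gamma> * (1 - t) * (1 - t - 1) / ((1 - s) * (1 - s - 1) * (1 - s - (1 - t))) = - (\<gamma> * t * (t - 1) / (s * (s - 1) * (s - t)))"
      "(1 - \<beta> - \<alpha>) * \<gamma> / ((1 - s) * (1 - s - 1)) = (1 - \<alpha> - \<beta>) * \<gamma> / (s * (s - 1))"
      "a / (1 - s - (1 - t)) = - (a / (s - t))" for a s t :: complex
    proof -
      have m: "1 - s = - (s - 1)" "1 - s - 1 = - s" "1 - s - (1 - t) = - (s - t)" "(1 - s) * (1 - s - 1) = s * (s - 1)"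
        "\<gamma> * (1 - t) * (1 - t - 1) = \<gamma> * t * (t - 1)" "1 - \<beta> - \<alpha> = 1 - \<alpha> - \<beta>"
        by (simp_all add: algebra_simps)
      show "a / (1 - s - (1 - t)) = - (a / (s - t))" unfolding m(3) by (rule divide_minus_right)
      show "(1 - \<beta> - \<alpha>) * \<gamma> / ((1 - s) * (1 - s - 1)) = (1 - \<alpha> - \<beta>) * \<gamma> / (s * (s - 1))"
        unfolding m(4,6) ..
      show "\<gamma> * (1 - t) * (1 - t - 1) / ((1 - s) * (1 - s - 1) * (1 - s - (1 - t))) = - (\<gamma> * t * (t - 1) / (s * (s - 1) * (s - t)))"
        unfolding m(3,4,5) by (simp only: mult_minus_right divide_minus_right)
      show "\<beta> / (1 - s) + \<alpha> / (1 - s - 1) + (- \<gamma>) / (1 - s - (1 - t)) = - (\<alpha> / s + \<beta> / (s - 1) + (- \<gamma>) / (s - t))"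
        unfolding m(2,3) unfolding m(1) divide_minus_right by simp
    qed
    show "pd1 (pd1 ?w) (x, y)
         + (\<alpha> / x + \<beta> / (x - 1) + (- \<gamma>) / (x - y)) * pd1 ?w (x, y)
         + (\<gamma> * y * (y - 1)) / (x * (x - 1) * (x - y)) * pd2 ?w (x, y)
         + ((1 - \<alpha> - \<beta>) * \<gamma>) / (x * (x - 1)) * ?w (x, y) = 0 \<and>
       pd2 (pd2 ?w) (x, y)
         + (\<alpha> / y + \<beta> / (y - 1) + (- \<gamma>) / (y - x)) * pd2 ?w (x, y)
         + (\<gamma> * x * (x - 1)) / (y * (y - 1) * (y - x)) * pd1 ?w (x, y)
         + ((1 - \<alpha> - \<beta>) * \<gamma>) / (y * (y - 1)) * ?w (x, y) = 0 \<and>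
       pd1 (pd2 ?w) (x, y) = (- \<gamma>) / (x - y) * pd1 ?w (x, y) + \<gamma> / (x - y) * pd2 ?w (x, y)"
      \<comment> \<open>The order matters: \<open>e(4)\<close> would rewrite a quotient inside the
        left-hand side of \<open>e(1)\<close>.\<close>
      using E unfolding pd[OF v] pdpd[OF v] r unfolding e(1-3) unfolding e(4)
      by (simp only: mult_minus_left mult_minus_right)
  qed
qed

theorem theorem3p3:
  fixes \<alpha> \<beta> \<gamma> :: complex and D :: "(complex \<times> complex) set"
  assumes "open D" and "simply_connected D"
    and "\<And>v1 v2. (v1, v2) \<in> D \<Longrightarrow>
           v1 \<noteq> 0 \<and> v1 \<noteq> 1 \<and> v2 \<noteq> 0 \<and> v2 \<noteq> 1 \<and> v1 \<noteq> v2"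
  shows
    "(\<forall>z p1 p2 p3 p4 p5.
        solves_z_system \<alpha> \<beta> \<gamma> D z \<and>
        power_branch D (\<lambda>(v1, v2). v1) (- \<alpha> / 3) p1 \<and>
        power_branch D (\<lambda>(v1, v2). v2) (- \<alpha> / 3) p2 \<and>
        power_branch D (\<lambda>(v1, v2). v1 - 1) (- \<beta> / 3) p3 \<and>
        power_branch D (\<lambda>(v1, v2). v2 - 1) (- \<beta> / 3) p4 \<and>
        power_branch D (\<lambda>(v1, v2). v1 - v2) (2 * \<gamma> / 3) p5 \<longrightarrow>
        solves_w_system \<alpha> \<beta> \<gamma> D (\<lambda>v. p1 v * p2 v * p3 v * p4 v * p5 v * z v))
     \<and>
     (\<forall>C1 C2 f1 f2.
        (C1 \<noteq> 0 \<longrightarrow> \<alpha> - \<gamma> \<notin> \<int>\<^sub>\<le>\<^sub>0 \<and>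
           appell_F1_branch (\<alpha> + \<beta> - 1) (- \<gamma>) (- \<gamma>) (\<alpha> - \<gamma>) D f1) \<and>
        (C2 \<noteq> 0 \<longrightarrow> \<beta> - \<gamma> \<notin> \<int>\<^sub>\<le>\<^sub>0 \<and>
           appell_F1_branch (\<alpha> + \<beta> - 1) (- \<gamma>) (- \<gamma>) (\<beta> - \<gamma>)
             ((\<lambda>(v1, v2). (1 - v1, 1 - v2)) ` D) f2) \<longrightarrow>
        solves_w_system \<alpha> \<beta> \<gamma> D
          (\<lambda>(v1, v2). C1 * f1 (v1, v2) + C2 * f2 (1 - v1, 1 - v2)) \<and>
        (\<forall>q1 q2 q3 q4 q5.
           power_branch D (\<lambda>(v1, v2). v1) (\<alpha> / 3) q1 \<and>
           power_branch D (\<lambda>(v1, v2). v2) (\<alpha> / 3) q2 \<and>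
           power_branch D (\<lambda>(v1, v2). v1 - 1) (\<beta> / 3) q3 \<and>
           power_branch D (\<lambda>(v1, v2). v2 - 1) (\<beta> / 3) q4 \<and>
           power_branch D (\<lambda>(v1, v2). v1 - v2) (- 2 * \<gamma> / 3) q5 \<longrightarrow>
           solves_z_system \<alpha> \<beta> \<gamma> D
             (\<lambda>(v1, v2). q1 (v1, v2) * q2 (v1, v2) * q3 (v1, v2) * q4 (v1, v2) * q5 (v1, v2)
                * (C1 * f1 (v1, v2) + C2 * f2 (1 - v1, 1 - v2)))))"
proof (intro conjI allI impI; (elim conjE)?)
  have D: "nonsingular D" using assms(3) by (auto simp: nonsingular_def)
  have ne: "v1 \<noteq> v2" if "(v1, v2) \<in> D" for v1 v2 using assms(3) that by blast
  {
    fix z p1 p2 p3 p4 p5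
    assume z: "solves_z_system \<alpha> \<beta> \<gamma> D z"
      and p: "power_branch D (\<lambda>(v1, v2). v1) (- \<alpha> / 3) p1" "power_branch D (\<lambda>(v1, v2). v2) (- \<alpha> / 3) p2"
        "power_branch D (\<lambda>(v1, v2). v1 - 1) (- \<beta> / 3) p3" "power_branch D (\<lambda>(v1, v2). v2 - 1) (- \<beta> / 3) p4"
        "power_branch D (\<lambda>(v1, v2). v1 - v2) (2 * \<gamma> / 3) p5"
    show "solves_w_system \<alpha> \<beta> \<gamma> D (\<lambda>v. p1 v * p2 v * p3 v * p4 v * p5 v * z v)"
      by (rule solves_w_systemI_gauge[OF \<open>open D\<close> D z])
        (rule power_product_log_partials[OF \<open>open D\<close> p ne])
  next
    fix C1 C2 :: complex and f1 f2 :: "complex \<times> complex \<Rightarrow> complex"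
    assume f1: "C1 \<noteq> 0 \<longrightarrow> \<alpha> - \<gamma> \<notin> \<int>\<^sub>\<le>\<^sub>0 \<and>
           appell_F1_branch (\<alpha> + \<beta> - 1) (- \<gamma>) (- \<gamma>) (\<alpha> - \<gamma>) D f1"
      and f2: "C2 \<noteq> 0 \<longrightarrow> \<beta> - \<gamma> \<notin> \<int>\<^sub>\<le>\<^sub>0 \<and>
           appell_F1_branch (\<alpha> + \<beta> - 1) (- \<gamma>) (- \<gamma>) (\<beta> - \<gamma>)
             ((\<lambda>(v1, v2). (1 - v1, 1 - v2)) ` D) f2"
    \<comment> \<open>A function with coefficient 0 is arbitrary, possibly not even continuous, so it is replaced by 0.\<close>
    define g1 where "g1 = (if C1 = 0 then (\<lambda>_. 0) else f1)"
    define g2 where "g2 = (if C2 = 0 then (\<lambda>_. 0) else (\<lambda>v. f2 (reflection v)))"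
    have "solves_w_system \<alpha> \<beta> \<gamma> D g1"
    proof (cases "C1 = 0")
      case True
      then show ?thesis by (simp add: g1_def solves_w_system_zero)
    next
      case False
      with f1 have "solves_appell_system (\<alpha> + \<beta> - 1) (- \<gamma>) (- \<gamma>) (\<alpha> - \<gamma>) D f1"
        using appell_F1_branch_solves by blast
      then show ?thesis using False D by (simp add: g1_def solves_w_systemI_appell)
    qed
    moreover have "solves_w_system \<alpha> \<beta> \<gamma> D g2"
    proof (cases "C2 = 0")
      case True
      then show ?thesis by (simp add: g2_def solves_w_system_zero)
    next
      case False
      \<comment> \<open>Exchanging \<alpha> and \<beta> changes only the last parameter of the
        Appell function, as \<open>\<alpha> + \<beta> - 1\<close> is symmetric. Hence
        \<open>f2\<close> solves the exchanged \<open>w\<close>-system on the reflected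
        domain.\<close>
      have "reflection = (\<lambda>(v1, v2). (1 - v1, 1 - v2))" by (auto simp: reflection_def)
      with f2 False have "solves_appell_system (\<beta> + \<alpha> - 1) (- \<gamma>) (- \<gamma>) (\<beta> - \<gamma>) (reflection ` D) f2"
        using appell_F1_branch_solves by (simp add: add.commute)
      then have "solves_w_system \<beta> \<alpha> \<gamma> (reflection ` D) f2"
        by (rule solves_w_systemI_appell) (rule nonsingular_reflection[OF D])
      then show ?thesis using False \<open>open D\<close> by (simp add: g2_def solves_w_system_reflection)
    qed
    ultimately have "solves_w_system \<alpha> \<beta> \<gamma> D (\<lambda>v. C1 * g1 v + C2 * g2 v)"
      using \<open>open D\<close> by (rule solves_w_system_linear)
    moreover have eq: "C1 * g1 (v1, v2) + C2 * g2 (v1, v2) = C1 * f1 (v1, v2) + C2 * f2 (1 - v1, 1 - v2)" for v1 v2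
      by (simp add: g1_def g2_def reflection_def)
    ultimately show w: "solves_w_system \<alpha> \<beta> \<gamma> D (\<lambda>(v1, v2). C1 * f1 (v1, v2) + C2 * f2 (1 - v1, 1 - v2))"
      unfolding eq[symmetric] by (simp add: case_prod_unfold)
    fix q1 q2 q3 q4 q5
    assume q: "power_branch D (\<lambda>(v1, v2). v1) (\<alpha> / 3) q1" "power_branch D (\<lambda>(v1, v2). v2) (\<alpha> / 3) q2"
      "power_branch D (\<lambda>(v1, v2). v1 - 1) (\<beta> / 3) q3" "power_branch D (\<lambda>(v1, v2). v2 - 1) (\<beta> / 3) q4"
      "power_branch D (\<lambda>(v1, v2). v1 - v2) (- 2 * \<gamma> / 3) q5"
    have "solves_z_system \<alpha> \<beta> \<gamma> D (\<lambda>v. q1 v * q2 v * q3 v * q4 v * q5 v *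
        (case v of (v1, v2) \<Rightarrow> C1 * f1 (v1, v2) + C2 * f2 (1 - v1, 1 - v2)))"
      by (rule solves_z_systemI_gauge[OF \<open>open D\<close> D w])
        (rule power_product_log_partials[OF \<open>open D\<close> q ne])
    then show "solves_z_system \<alpha> \<beta> \<gamma> D
             (\<lambda>(v1, v2). q1 (v1, v2) * q2 (v1, v2) * q3 (v1, v2) * q4 (v1, v2) * q5 (v1, v2)
                * (C1 * f1 (v1, v2) + C2 * f2 (1 - v1, 1 - v2)))"
      by (simp add: case_prod_unfold)
  }
qed

end
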